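(* Let $X$ be a set, $k$ a field, $I$ an ideal of the semiring algebra $kRig\langle X\rangle$ and $>$ a monomial ordering on the free semiring $Rig\langle X\rangle$. Then there exists a unique reduced Gröbner-Shirshov basis $S$ for $I$.
   Context: A semiring $(A,\circ,\cdot,\theta,1)$ consists of a commutative monoid $(A,\circ,\theta)$ and a monoid $(A,\cdot,1)$ such that $\theta\cdot a=a\cdot\theta=\theta$ for all $a$ and $\cdot$ distributes over $\circ$ on both sides. $Rig\langle X\rangle$ is the free semiring on $X$; with $X^*$ the free monoid on $X$, its elements (called monomials) are the finite multisets $u_1\circ u_2\circ\cdots\circ u_n$ of words $u_i\in X^*$, $n\ge 0$ ($n=0$ gives $\theta$). Write $|u_1\circ\cdots\circ u_n|_\circ=n$. $kRig\langle X\rangle$ is the $k$-vector space with basis $Rig\langle X\rangle$, with $\circ$ and $\cdot$ extended bilinearly; it is regarded as an $\Omega$-algebra with $\Omega=\{\cdot,\circ\}$, and "ideal" means $\Omega$-ideal, i.e. ideal with respect to both operations. $Id(S)$ is the ideal generated by $S$. Elements of $kRig\langle X\rangle$ are called polynomials. (The basis element $\theta$ is different from the zero vector $0$.) For monomials $u=w_1\circ\cdots\circ w_m\circ u_{m+1}\circ\cdots\circ u_n$ and $v=w_1\circ\cdots\circ w_m\circ v_{m+1}\circ\cdots\circ v_t$ with all $w_l,u_i,v_j\in X^*$ and $u_i\ne v_j$ for all $i,j>m$, put $lcm_\circ(u,v)=w_1\circ\cdots\circ w_m\circ u_{m+1}\circ\cdots\circ u_n\circ v_{m+1}\circ\cdots\circ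 v_t$. Let $\star\notin X$. A $\star$-monomial is a monomial in $Rig\langle X\cup\{\star\}\rangle$ with exactly one occurrence of $\star$; $u|_s$ denotes the result of substituting $s$ for $\star$ in $u$. A monomial ordering on $Rig\langle X\rangle$ is a well ordering $>$ such that $w>v$ implies $u|_w>u|_v$ for all monomials $v,w$ and all $\star$-monomials $u$. For a nonzero polynomial $f$, $\bar f$ is its leading (largest) monomial; $f$ is monic if $\bar f$ has coefficient $1$. Compositions of monic polynomials $f,g$: (I) if $a,b\in X^*$ satisfy $|lcm_\circ(\bar fa,b\bar g)|_\circ<|\bar fa|_\circ+|b\bar g|_\circ$, then $(f,g)_w=fa\circ u-bg\circ v$, where $w=lcm_\circ(\bar fa,b\bar g)=\bar fa\circ u=b\bar g\circ v$; (II) if $a,b\in X^*$ satisfy $|lcm_\circ(\bar f,a\bar gb)|_\circ<|\bar f|_\circ+|a\bar gb|_\circ$, then $(f,g)_w=f\circ u-agb\circ v$, where $w=lcm_\circ(\bar f,a\bar gb)=\bar f\circ u=a\bar gb\circ v$. For a set $S$ of monic polynomials and a monomial $w$, a polynomial $h$ is trivial modulo $(S,w)$ if $h=\sum_i\alpha_ia_is_ib_i\circ u_i$ (finite sum) with $\alpha_i\in k$, $a_i,b_i\in X^*$, $u_i\in Rig\langle X\rangle$, $s_i\in S$ and $a_i\overline{s_i}b_i\circ u_i<w$ for all $i$. A set $S$ of monic polynomials is a Gröbner-Shirshov basis in $kRig\langle X\rangle$ if every composition $(f,g)_w$ with $f,g\in S$ is trivial modulo $(S,w)$; it is then called a Gröbner-Shirshov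 basis for the ideal $Id(S)$. $Irr(S)=\{w\in Rig\langle X\rangle\mid w\ne a\bar sb\circ u\text{ for any }a,b\in X^*,u\in Rig\langle X\rangle,s\in S\}$. For $s=\sum_{i=1}^n\alpha_iu_i$ with $0\ne\alpha_i\in k$ and distinct $u_i\in Rig\langle X\rangle$, $supp(s)=\{u_1,\dots,u_n\}$. A Gröbner-Shirshov basis $S$ is reduced if $supp(s)\subseteq Irr(S-\{s\})$ for every $s\in S$.
   Formalization: "Ideal" here means a subspace closed under ∘ with all polynomials but under · only with words of X*, and Id(S) is meant in this sense; with closure under · by all polynomials uniqueness fails, since {θ} and {1} are both reduced bases generating kRig⟨X⟩. *)

theory Defs
  imports "HOL-Library.Poly_Mapping" "HOL-Library.Multiset"
begin

text \<open>
  Free semirings \<open>Rig\<langle>X\<rangle>\<close> and their semiring algebras \<open>kRig\<langle>X\<rangle>\<close> over an arbitrary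
  (possibly empty) set \<open>X\<close>. A monomial \<open>u\<^sub>1 \<circ> \<dots> \<circ> u\<^sub>n\<close> is the multiset \<open>{#u\<^sub>1, \<dots>, u\<^sub>n#}\<close> of words,
  so \<open>\<circ>\<close> is \<open>+\<close>, \<open>\<theta>\<close> is \<open>{#}\<close>, \<open>|u|\<^sub>\<circ>\<close> is \<open>size u\<close>, and the word \<open>a\<close> is the monomial
  \<open>{#a#}\<close>; in particular \<open>1\<close> is \<open>{#[]#}\<close>.

  A polynomial is a finitely supported function from monomials to \<open>k\<close>. The bilinear extension
  of \<open>\<circ>\<close> is the multiplication \<open>*\<close> of type \<open>\<Rightarrow>\<^sub>0\<close>, since that is convolution with respect to
  \<open>+\<close> on the exponents. The constant \<open>1 = single {#} 1\<close> of that type is therefore the basis element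
  \<open>\<theta>\<close>, and not the \<open>1\<close> of the semiring.
\<close>

type_synonym 'x mono = "'x list multiset"
type_synonym ('x, 'k) rpoly = "'x list multiset \<Rightarrow>\<^sub>0 'k"

definition rig :: "'x set \<Rightarrow> 'x mono set" where
  "rig X = {u. set_mset u \<subseteq> lists X}"

definition mdot :: "'x mono \<Rightarrow> 'x mono \<Rightarrow> 'x mono"  (infixl \<open>\<cdot>\<close> 75) where
  "u \<cdot> v = (\<Sum>p\<in>#u. image_mset (\<lambda>q. p @ q) v)"

definition krig :: "'x set \<Rightarrow> ('x, 'k::field) rpoly set" where
  "krig X = {f. Poly_Mapping.keys f \<subseteq> rig X}"

abbreviation mon :: "'x mono \<Rightarrow> ('x, 'k::field) rpoly" where
  "mon u \<equiv> Poly_Mapping.single u 1"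

definition scale :: "'k \<Rightarrow> ('x, 'k::field) rpoly \<Rightarrow> ('x, 'k) rpoly" where
  "scale c f = Poly_Mapping.map ((*) c) f"

definition pdot :: "('x, 'k::field) rpoly \<Rightarrow> ('x, 'k) rpoly \<Rightarrow> ('x, 'k) rpoly"
    (infixl \<open>\<odot>\<close> 75) where
  "f \<odot> g = (\<Sum>u\<in>Poly_Mapping.keys f. \<Sum>v\<in>Poly_Mapping.keys g.
     Poly_Mapping.single (u \<cdot> v) (Poly_Mapping.lookup f u * Poly_Mapping.lookup g v))"


subsection \<open>Ideals\<close>

text \<open>
  An ideal is a subspace closed under \<open>\<circ>\<close> with arbitrary polynomials and under \<open>\<cdot>\<close> on both sides
  with words; equivalently, a subspace closed under the substitutions \<open>f \<mapsto> a f b \<circ> u\<close> into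
  \<open>\<star>\<close>-monomials. The ideal generated by \<open>S\<close> is then the linear span of the polynomials
  \<open>a s b \<circ> u\<close>.

  One cannot require closure under \<open>\<cdot>\<close> with arbitrary polynomials: for \<open>f = \<Sum> \<alpha>\<^sub>i u\<^sub>i\<close>, bilinearity
  gives \<open>f \<cdot> \<theta> = (\<Sum> \<alpha>\<^sub>i) \<theta>\<close>, and \<open>\<theta>\<close> is the unit of \<open>\<circ>\<close>. So such an ideal is all of
  \<open>kRig\<langle>X\<rangle>\<close> as soon as it contains a polynomial with nonzero coefficient sum (lemma
  \<open>omega_ideal_eq_krig\<close>). In particular \<open>kRig\<langle>X\<rangle>\<close> would be generated by \<open>{u}\<close> for every monomial
  \<open>u\<close>; all these singletons are reduced Groebner-Shirshov bases, so uniqueness would fail.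
  Ideals of the stronger kind, \<open>omega_ideal\<close> below, are ideals in the present sense, and a set that
  generates one of them in the present sense also generates it in the stronger sense.
\<close>

definition rig_ideal :: "'x set \<Rightarrow> ('x, 'k::field) rpoly set \<Rightarrow> bool" where
  "rig_ideal X I \<longleftrightarrow>
     I \<subseteq> krig X \<and> 0 \<in> I \<and>
     (\<forall>f\<in>I. \<forall>g\<in>I. f + g \<in> I) \<and>
     (\<forall>c. \<forall>f\<in>I. scale c f \<in> I) \<and>
     (\<forall>f\<in>I. \<forall>g\<in>krig X. f * g \<in> I) \<and>
     (\<forall>f\<in>I. \<forall>a\<in>lists X. mon {#a#} \<odot> f \<in> I \<and> f \<odot> mon {#a#} \<in> I)"

definition generated_ideal :: "'x set \<Rightarrow> ('x, 'k::field) rpoly set \<Rightarrow> ('x, 'k) rpoly set" where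
  "generated_ideal X S = \<Inter> {I. rig_ideal X I \<and> S \<subseteq> I}"

definition omega_ideal :: "'x set \<Rightarrow> ('x, 'k::field) rpoly set \<Rightarrow> bool" where
  "omega_ideal X I \<longleftrightarrow>
     I \<subseteq> krig X \<and> 0 \<in> I \<and>
     (\<forall>f\<in>I. \<forall>g\<in>I. f + g \<in> I) \<and>
     (\<forall>c. \<forall>f\<in>I. scale c f \<in> I) \<and>
     (\<forall>f\<in>I. \<forall>g\<in>krig X. f * g \<in> I) \<and>
     (\<forall>f\<in>I. \<forall>g\<in>krig X. g \<odot> f \<in> I \<and> f \<odot> g \<in> I)"

lemma omega_ideal_imp_rig_ideal:
  assumes "omega_ideal X I"
  shows "rig_ideal X I"
proof -
  have "mon {#a#} \<in> krig X" if "a \<in> lists X" for a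
    using that by (auto simp: krig_def rig_def)
  then show ?thesis
    using assms unfolding omega_ideal_def rig_ideal_def by blast
qed

lemma generated_eq_imp_omega_generated:
  assumes "omega_ideal X I" and "generated_ideal X S = I"
  shows "\<Inter> {J. omega_ideal X J \<and> S \<subseteq> J} = I"
proof -
  have "S \<subseteq> I"
    using assms(2) unfolding generated_ideal_def by blast
  moreover have "I \<subseteq> J" if "omega_ideal X J" "S \<subseteq> J" for J
    using assms(2) omega_ideal_imp_rig_ideal[OF that(1)] that(2) unfolding generated_ideal_def by blast
  ultimately show ?thesis
    using assms(1) by blast
qed

lemma omega_ideal_eq_krig:
  fixes I :: "('x, 'k::field) rpoly set"
  assumes I: "omega_ideal X I" and f: "f \<in> I" and c: "(\<Sum>u\<in>Poly_Mapping.keys f. Poly_Mapping.lookup f u) \<noteq> 0"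
  shows "I = krig X"
proof -
  define c where "c = (\<Sum>u\<in>Poly_Mapping.keys f. Poly_Mapping.lookup f u)"
  have "mon {#} \<in> (krig X :: ('x, 'k) rpoly set)"
    by (simp add: krig_def rig_def)
  then have "f \<odot> mon {#} \<in> I"
    using I f unfolding omega_ideal_def by blast
  moreover have "f \<odot> mon {#} = Poly_Mapping.single {#} c"
  proof (rule poly_mapping_eqI)
    fix k
    show "Poly_Mapping.lookup (f \<odot> mon {#}) k = Poly_Mapping.lookup (Poly_Mapping.single {#} c) k"
      by (simp add: pdot_def mdot_def c_def lookup_sum lookup_single when_def)
  qed
  ultimately have "scale (inverse c) (Poly_Mapping.single {#} c) \<in> I"
    using I unfolding omega_ideal_def by auto
  then have one: "(1 :: ('x, 'k) rpoly) \<in> I"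
    using c by (simp add: scale_def c_def when_def flip: single_one)
  have "g \<in> I" if "g \<in> krig X" for g
    using I one that unfolding omega_ideal_def by (metis mult_1)
  then show ?thesis
    using I unfolding omega_ideal_def by blast
qed


subsection \<open>Monomial orderings\<close>

text \<open>
  \<open>\<star>\<close>-monomials are monomials over \<open>X \<union> {\<star>}\<close>, with the letter \<open>\<star>\<close> encoded as \<open>None\<close> and a letter
  \<open>x \<in> X\<close> as \<open>Some x\<close>. Substitution replaces the letters of a word by monomials and multiplies
  them with \<open>\<cdot>\<close>, whose unit is \<open>{#[]#}\<close>.
\<close>

definition star_mono :: "'x set \<Rightarrow> 'x option mono \<Rightarrow> bool" where
  "star_mono X u \<longleftrightarrow>
     u \<in> rig (insert None (Some ` X)) \<and> (\<Sum>p\<in>#u. count_list p None) = 1"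

primrec subst_word :: "'x option list \<Rightarrow> 'x mono \<Rightarrow> 'x mono" where
  "subst_word [] s = {#[]#}"
| "subst_word (y # p) s = (case y of None \<Rightarrow> s | Some x \<Rightarrow> {#[x]#}) \<cdot> subst_word p s"

definition star_subst :: "'x option mono \<Rightarrow> 'x mono \<Rightarrow> 'x mono" where
  "star_subst u s = (\<Sum>p\<in>#u. subst_word p s)"

abbreviation less_in :: "'a rel \<Rightarrow> 'a \<Rightarrow> 'a \<Rightarrow> bool" where
  "less_in r v w \<equiv> (v, w) \<in> r \<and> v \<noteq> w"

text \<open>The relation \<open>r\<close> is the reflexive version of the ordering: \<open>(v, w) \<in> r\<close> means \<open>v \<le> w\<close>.\<close>

definition monomial_ordering :: "'x set \<Rightarrow> 'x mono rel \<Rightarrow> bool" where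
  "monomial_ordering X r \<longleftrightarrow>
     well_order_on (rig X) r \<and>
     (\<forall>v\<in>rig X. \<forall>w\<in>rig X. \<forall>u. star_mono X u \<and> less_in r v w \<longrightarrow>
        less_in r (star_subst u v) (star_subst u w))"

definition lm :: "'x mono rel \<Rightarrow> ('x, 'k::field) rpoly \<Rightarrow> 'x mono" where
  "lm r f = (THE w. w \<in> Poly_Mapping.keys f \<and> (\<forall>v\<in>Poly_Mapping.keys f. (v, w) \<in> r))"

definition monic :: "'x mono rel \<Rightarrow> ('x, 'k::field) rpoly \<Rightarrow> bool" where
  "monic r f \<longleftrightarrow> f \<noteq> 0 \<and> Poly_Mapping.lookup f (lm r f) = 1"


subsection \<open>Compositions and Groebner-Shirshov bases\<close>

text \<open>The common part \<open>w\<^sub>1 \<circ> \<dots> \<circ> w\<^sub>m\<close>, followed by the remaining words of \<open>u\<close> and those of \<open>v\<close>.\<close>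

definition lcm_circ :: "'x mono \<Rightarrow> 'x mono \<Rightarrow> 'x mono" where
  "lcm_circ u v = (u \<inter># v) + (u - v) + (v - u)"

abbreviation msandwich :: "'x list \<Rightarrow> 'x mono \<Rightarrow> 'x list \<Rightarrow> 'x mono" where
  "msandwich a u b \<equiv> {#a#} \<cdot> u \<cdot> {#b#}"

abbreviation psandwich :: "'x list \<Rightarrow> ('x, 'k::field) rpoly \<Rightarrow> 'x list \<Rightarrow> ('x, 'k) rpoly" where
  "psandwich a f b \<equiv> mon {#a#} \<odot> f \<odot> mon {#b#}"

definition composition1 ::
  "'x set \<Rightarrow> 'x mono rel \<Rightarrow> ('x, 'k::field) rpoly \<Rightarrow> ('x, 'k) rpoly \<Rightarrow>
   'x mono \<Rightarrow> ('x, 'k) rpoly \<Rightarrow> bool" where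
  "composition1 X r f g w h \<longleftrightarrow>
     (\<exists>a\<in>lists X. \<exists>b\<in>lists X. \<exists>u v.
        let p = lm r f \<cdot> {#a#}; q = {#b#} \<cdot> lm r g in
        size (lcm_circ p q) < size p + size q \<and>
        w = lcm_circ p q \<and> w = p + u \<and> w = q + v \<and>
        h = (f \<odot> mon {#a#}) * mon u - (mon {#b#} \<odot> g) * mon v)"

definition composition2 ::
  "'x set \<Rightarrow> 'x mono rel \<Rightarrow> ('x, 'k::field) rpoly \<Rightarrow> ('x, 'k) rpoly \<Rightarrow>
   'x mono \<Rightarrow> ('x, 'k) rpoly \<Rightarrow> bool" where
  "composition2 X r f g w h \<longleftrightarrow>
     (\<exists>a\<in>lists X. \<exists>b\<in>lists X. \<exists>u v.
        let p = lm r f; q = msandwich a (lm r g) b in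
        size (lcm_circ p q) < size p + size q \<and>
        w = lcm_circ p q \<and> w = p + u \<and> w = q + v \<and>
        h = f * mon u - psandwich a g b * mon v)"

definition trivial_mod ::
  "'x set \<Rightarrow> 'x mono rel \<Rightarrow> ('x, 'k::field) rpoly set \<Rightarrow> 'x mono \<Rightarrow> ('x, 'k) rpoly \<Rightarrow> bool"
where
  "trivial_mod X r S w h \<longleftrightarrow>
     (\<exists>(n::nat) \<alpha> a s b u.
        (\<forall>i<n. a i \<in> lists X \<and> b i \<in> lists X \<and> u i \<in> rig X \<and> s i \<in> S \<and>
               less_in r (msandwich (a i) (lm r (s i)) (b i) + u i) w) \<and>
        h = (\<Sum>i<n. scale (\<alpha> i) (psandwich (a i) (s i) (b i) * mon (u i))))"

definition gs_basis :: "'x set \<Rightarrow> 'x mono rel \<Rightarrow> ('x, 'k::field) rpoly set \<Rightarrow> bool" where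
  "gs_basis X r S \<longleftrightarrow>
     S \<subseteq> krig X \<and> (\<forall>s\<in>S. monic r s) \<and>
     (\<forall>f\<in>S. \<forall>g\<in>S. \<forall>w h. composition1 X r f g w h \<or> composition2 X r f g w h \<longrightarrow>
        trivial_mod X r S w h)"

definition gs_basis_for ::
  "'x set \<Rightarrow> 'x mono rel \<Rightarrow> ('x, 'k::field) rpoly set \<Rightarrow> ('x, 'k) rpoly set \<Rightarrow> bool" where
  "gs_basis_for X r I S \<longleftrightarrow> gs_basis X r S \<and> generated_ideal X S = I"

definition Irr :: "'x set \<Rightarrow> 'x mono rel \<Rightarrow> ('x, 'k::field) rpoly set \<Rightarrow> 'x mono set" where
  "Irr X r S =
     {w \<in> rig X. \<forall>a\<in>lists X. \<forall>b\<in>lists X. \<forall>u\<in>rig X. \<forall>s\<in>S.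
        w \<noteq> msandwich a (lm r s) b + u}"

definition reduced :: "'x set \<Rightarrow> 'x mono rel \<Rightarrow> ('x, 'k::field) rpoly set \<Rightarrow> bool" where
  "reduced X r S \<longleftrightarrow> (\<forall>s\<in>S. Poly_Mapping.keys s \<subseteq> Irr X r (S - {s}))"

end

theory Submission
  imports Defs
begin

text \<open>
  Everything is controlled by the set \<open>M\<close> of leading monomials of the nonzero elements of \<open>I\<close>. The
  maps \<open>w \<mapsto> a w b \<circ> u\<close> are strictly increasing for the ordering, so they send leading monomials to
  leading monomials; hence \<open>M\<close> is closed under them, and a monomial is never smaller than one that
  divides it (\<open>preceq_if_divides\<close>). Divisibility is therefore well founded.

  Existence. For a monomial \<open>w\<close> minimal in \<open>M\<close> under divisibility, subtract from \<open>w\<close> its normal form,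
  a polynomial that is congruent to \<open>w\<close> modulo \<open>I\<close> and has no monomial in \<open>M\<close> (\<open>ex_normal_form\<close>). The
  result is a monic element of \<open>I\<close> whose only monomial in \<open>M\<close> is \<open>w\<close>. The set \<open>S\<close> of all such elements
  is reduced. Its leading monomials divide all of \<open>M\<close>, so the division algorithm writes every
  element \<open>f\<close> of \<open>I\<close> as a combination of polynomials \<open>a s b \<circ> u\<close> whose leading monomials do not exceed
  that of \<open>f\<close> (\<open>comb_lead_bound\<close>). In a composition the leading monomials cancel, so this
  representation shows that the composition is trivial (\<open>gs_basis_forI\<close>).

  Uniqueness. By \<open>composition_diamond\<close>, the leading monomials of a Groebner-Shirshov basis of \<open>I\<close>
  divide all of \<open>M\<close>. If the basis is reduced, they are then exactly the minimal elements of \<open>M\<close>, so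
  two reduced bases have the same leading monomials. If \<open>s\<close> and \<open>t\<close> are elements of the two bases with
  the same leading monomial and \<open>s \<noteq> t\<close>, then the leading monomial of \<open>s - t\<close> lies in \<open>M\<close>, is smaller
  than that of \<open>s\<close> and occurs in \<open>s\<close> or \<open>t\<close>, which contradicts reducedness (\<open>reduced_subset\<close>).

  The composition-diamond lemma rests on \<open>comb_same_lead\<close>: two polynomials \<open>a f b \<circ> u\<close> and
  \<open>a' g b' \<circ> u'\<close> with the same leading monomial \<open>w\<close> differ by a combination of terms below \<open>w\<close>. If the
  multisets of words \<open>a \<cdot> lm f \<cdot> b\<close> and \<open>a' \<cdot> lm g \<cdot> b'\<close> are disjoint, this is the commutativity of \<open>\<circ>\<close>.
  If they share a word \<open>a x b = a' y b'\<close>, then one of \<open>a\<close>, \<open>a'\<close> is a prefix of the other and one of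
  \<open>b\<close>, \<open>b'\<close> is a suffix of the other, and cancelling the common outer parts leaves exactly a
  composition of type I or II.
\<close>

section \<open>Contexts\<close>

text \<open>
  The monomial \<open>a w b \<circ> u\<close>, that is, the result of substituting \<open>w\<close> into the general \<open>\<star>\<close>-monomial.
  It is treated as a map of \<open>w\<close> because such maps are injective, strictly increasing and closed under
  composition (\<open>inj_ctx\<close>, \<open>ctx_strict_mono\<close>, \<open>ctx_ctx\<close>).
\<close>

definition ctx :: "'x list \<Rightarrow> 'x list \<Rightarrow> 'x mono \<Rightarrow> 'x mono \<Rightarrow> 'x mono" where
  "ctx a b u w = image_mset (\<lambda>p. a @ p @ b) w + u"

lemma mdot_word_left: "{#a#} \<cdot> w = image_mset (\<lambda>p. a @ p) w"
  by (simp add: mdot_def)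

lemma mdot_word_right: "w \<cdot> {#b#} = image_mset (\<lambda>p. p @ b) w"
  unfolding mdot_def by (induction w) auto

lemma msandwich_eq_ctx: "msandwich a w b = ctx a b {#} w"
  by (simp add: mdot_word_left mdot_word_right ctx_def multiset.map_comp comp_def)

lemma ctx_plus: "ctx a b {#} w + u = ctx a b u w"
  by (simp add: ctx_def)

lemma ctx_ctx: "ctx a b u (ctx a' b' u' w) = ctx (a @ a') (b' @ b) (ctx a b u u') w"
  by (simp add: ctx_def multiset.map_comp comp_def)

lemma ctx_Nil [simp]: "ctx [] [] u w = w + u"
  by (simp add: ctx_def)

lemma inj_ctx: "inj (ctx a b u)"
proof -
  have "inj (image_mset (\<lambda>p. a @ p @ b))"
    by (intro multiset.inj_map injI) simp
  then show ?thesis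
    by (simp add: ctx_def inj_def)
qed

lemma rig_empty [simp]: "{#} \<in> rig X"
  by (simp add: rig_def)

lemma rig_plus [simp]: "u + v \<in> rig X \<longleftrightarrow> u \<in> rig X \<and> v \<in> rig X"
  by (auto simp: rig_def)

lemma rig_diff: "u \<in> rig X \<Longrightarrow> u - v \<in> rig X"
  by (auto simp: rig_def dest: in_diffD)

lemma ctx_in_rig:
  "a \<in> lists X \<Longrightarrow> b \<in> lists X \<Longrightarrow> u \<in> rig X \<Longrightarrow> w \<in> rig X \<Longrightarrow> ctx a b u w \<in> rig X"
  by (fastforce simp: rig_def ctx_def)

text \<open>
  Words may repeat in a monomial, and the least common multiple takes each word with the larger
  of its two multiplicities. The cofactors are therefore differences of multisets.
\<close>

lemma lcm_circ_left: "lcm_circ p q = p + (q - p)"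
  unfolding lcm_circ_def by (rule multiset_eqI) auto

lemma lcm_circ_right: "lcm_circ p q = q + (p - q)"
  unfolding lcm_circ_def by (rule multiset_eqI) auto

text \<open>
  The size condition in the definition of compositions says that the two monomials share a word.
\<close>

lemma size_lcm_circ_less:
  assumes "p \<inter># q \<noteq> {#}"
  shows "size (lcm_circ p q) < size p + size q"
proof -
  have "lcm_circ p q + p \<inter># q = p + q"
    unfolding lcm_circ_def by (rule multiset_eqI) auto
  then have "size (lcm_circ p q) + size (p \<inter># q) = size p + size q"
    by (metis size_union)
  then show ?thesis
    using assms by (metis less_add_same_cancel1 nonempty_has_size)
qed

lemma image_mset_diff_ctx: "image_mset (\<lambda>p. a @ p @ b) (v - u) = ctx a b {#} v - ctx a b {#} u"
  by (simp add: ctx_def image_mset_diff_if_inj inj_def)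

definition divides_in :: "'x set \<Rightarrow> 'x mono \<Rightarrow> 'x mono \<Rightarrow> bool" where
  "divides_in X v w \<longleftrightarrow> (\<exists>a\<in>lists X. \<exists>b\<in>lists X. \<exists>u\<in>rig X. w = ctx a b u v)"

lemma divides_inI:
  "a \<in> lists X \<Longrightarrow> b \<in> lists X \<Longrightarrow> u \<in> rig X \<Longrightarrow> divides_in X v (ctx a b u v)"
  unfolding divides_in_def by blast

lemma divides_in_refl: "divides_in X v v"
  unfolding divides_in_def by (rule bexI[of _ "[]"], rule bexI[of _ "[]"], rule bexI[of _ "{#}"]) auto

lemma divides_in_trans:
  assumes "divides_in X u v" "divides_in X v w"
  shows "divides_in X u w"
proof -
  obtain a b x a' b' x' where "a \<in> lists X" "b \<in> lists X" "x \<in> rig X" "v = ctx a b x u"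
    "a' \<in> lists X" "b' \<in> lists X" "x' \<in> rig X" "w = ctx a' b' x' v"
    using assms unfolding divides_in_def by blast
  then show ?thesis
    unfolding divides_in_def
    by (intro bexI[of _ "a' @ a"] bexI[of _ "b @ b'"] bexI[of _ "ctx a' b' x' x"])
      (auto simp: ctx_ctx intro!: ctx_in_rig)
qed

lemma Irr_iff: "w \<in> Irr X r S \<longleftrightarrow> w \<in> rig X \<and> (\<forall>s\<in>S. \<not> divides_in X (lm r s) w)"
  unfolding Irr_def divides_in_def msandwich_eq_ctx ctx_plus by blast


section \<open>Linear extension of maps of monomials\<close>

text \<open>
  The linear map that sends a monomial \<open>w\<close> to \<open>\<tau> w\<close>. For \<open>\<tau> = ctx a b u\<close> it is the map
  \<open>f \<mapsto> a f b \<circ> u\<close> that generates ideals (\<open>psandwich_eq_push\<close>, \<open>push_ctx_times_mon\<close>).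
\<close>

definition push :: "('x mono \<Rightarrow> 'x mono) \<Rightarrow> ('x, 'k::field) rpoly \<Rightarrow> ('x, 'k) rpoly" where
  "push \<tau> f = (\<Sum>w\<in>Poly_Mapping.keys f. Poly_Mapping.single (\<tau> w) (Poly_Mapping.lookup f w))"

lemma lookup_scale [simp]: "Poly_Mapping.lookup (scale c f) w = c * Poly_Mapping.lookup f w"
  by (simp add: scale_def map.rep_eq when_def)

lemma scale_simps [simp]:
  "scale c 0 = 0" "scale 0 f = 0" "scale 1 f = f"
  "scale c (Poly_Mapping.single u d) = Poly_Mapping.single u (c * d)"
  "scale c (scale d f) = scale (c * d) f"
  by (auto intro!: poly_mapping_eqI simp: lookup_single when_def)

lemma scale_add: "scale c (f + g) = scale c f + scale c g"
  by (auto intro!: poly_mapping_eqI simp: lookup_add algebra_simps)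

lemma diff_eq_scale: "f - g = f + scale (-1) g"
  by (auto intro!: poly_mapping_eqI simp: lookup_add lookup_minus)

lemma keys_scale: "Poly_Mapping.keys (scale c f) \<subseteq> Poly_Mapping.keys f"
  by (auto simp: in_keys_iff)

lemma push_superset:
  assumes "finite A" "Poly_Mapping.keys f \<subseteq> A"
  shows "push \<tau> f = (\<Sum>w\<in>A. Poly_Mapping.single (\<tau> w) (Poly_Mapping.lookup f w))"
  unfolding push_def using assms by (intro sum.mono_neutral_left) (auto simp: in_keys_iff)

lemma push_0 [simp]: "push \<tau> 0 = 0"
  by (simp add: push_def)

lemma push_single [simp]: "push \<tau> (Poly_Mapping.single u c) = Poly_Mapping.single (\<tau> u) c"
  by (simp add: push_def)

lemma push_add: "push \<tau> (f + g) = push \<tau> f + push \<tau> g"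
proof -
  let ?A = "Poly_Mapping.keys f \<union> Poly_Mapping.keys g"
  have "Poly_Mapping.keys (f + g) \<subseteq> ?A"
    by (rule keys_add)
  then show ?thesis
    by (simp add: push_superset[of ?A] lookup_add single_add sum.distrib)
qed

lemma push_scale: "push \<tau> (scale c f) = scale c (push \<tau> f)"
proof -
  have "scale c (sum h A) = (\<Sum>w\<in>A. scale c (h w))" for h :: "'a mono \<Rightarrow> ('a, 'b) rpoly" and A
    by (induction A rule: infinite_finite_induct) (auto simp: scale_add)
  then show ?thesis
    unfolding push_superset[OF finite_keys keys_scale] by (simp add: push_def)
qed

lemma push_diff: "push \<tau> (f - g) = push \<tau> f - push \<tau> g"
  by (simp add: diff_eq_scale push_add push_scale)

lemma push_sum: "push \<tau> (sum h A) = (\<Sum>i\<in>A. push \<tau> (h i))"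
  by (induction A rule: infinite_finite_induct) (auto simp: push_add)

lemma push_ident: "push (\<lambda>w. w) f = f"
  unfolding push_def
  by (rule poly_mapping_eqI) (auto simp: lookup_sum lookup_single when_def in_keys_iff)

lemma push_push: "push \<sigma> (push \<tau> f) = push (\<lambda>w. \<sigma> (\<tau> w)) f"
  by (subst (2) push_def) (simp add: push_sum, simp add: push_def)

text \<open>
  For injective \<open>\<tau>\<close> no two monomials are merged, so coefficients are carried over without
  cancellation. Contexts are injective, so leading coefficients survive in \<open>a f b \<circ> u\<close>.
\<close>

lemma lookup_push:
  assumes "inj \<tau>"
  shows "Poly_Mapping.lookup (push \<tau> f) (\<tau> w) = Poly_Mapping.lookup f w"
  unfolding push_def using assms
  by (auto simp: lookup_sum lookup_single when_def in_keys_iff inj_eq)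

lemma keys_push:
  assumes "inj \<tau>"
  shows "Poly_Mapping.keys (push \<tau> f) = \<tau> ` Poly_Mapping.keys f"
proof
  show "Poly_Mapping.keys (push \<tau> f) \<subseteq> \<tau> ` Poly_Mapping.keys f"
    unfolding push_def by (rule order_trans[OF keys_sum]) auto
  show "\<tau> ` Poly_Mapping.keys f \<subseteq> Poly_Mapping.keys (push \<tau> f)"
    using assms by (auto simp: in_keys_iff lookup_push)
qed

lemma push_eq_0_iff: "inj \<tau> \<Longrightarrow> push \<tau> f = 0 \<longleftrightarrow> f = 0"
  using keys_push[of \<tau> f] by (metis image_is_empty keys_eq_empty)

lemma times_mon: "f * mon u = push (\<lambda>w. w + u) f"
proof -
  have "f * mon u = push (\<lambda>w. w) f * mon u"
    by (simp add: push_ident)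
  also have "\<dots> = push (\<lambda>w. w + u) f"
    unfolding push_def by (simp add: sum_distrib_right mult_single)
  finally show ?thesis .
qed

lemma times_mon_ctx: "f * mon u = push (ctx [] [] u) f"
  by (simp add: times_mon ctx_def[abs_def])

text \<open>
  Bilinearity of \<open>\<circ>\<close>: products with a polynomial reduce to products with monomials, which are
  contexts.
\<close>

lemma times_expand:
  "f * g = (\<Sum>v\<in>Poly_Mapping.keys g. scale (Poly_Mapping.lookup g v) (f * mon v))"
proof -
  have *: "f * Poly_Mapping.single v c = scale c (f * mon v)" for v c
  proof -
    have "scale c h = h * Poly_Mapping.single {#} c" for h :: "('a, 'b) rpoly"
    proof -
      have "h * Poly_Mapping.single {#} c = push (\<lambda>w. w) h * Poly_Mapping.single {#} c"
        by (simp add: push_ident)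
      also have "\<dots> = push (\<lambda>w. w) (scale c h)"
        unfolding push_superset[OF finite_keys keys_scale]
        by (simp only: push_def sum_distrib_right mult_single) (simp add: mult.commute)
      finally show ?thesis
        by (simp add: push_ident)
    qed
    then show ?thesis
      by (simp add: mult.assoc mult_single)
  qed
  have "f * g = f * push (\<lambda>w. w) g"
    by (simp add: push_ident)
  also have "\<dots> = (\<Sum>v\<in>Poly_Mapping.keys g. f * Poly_Mapping.single v (Poly_Mapping.lookup g v))"
    by (simp add: push_def sum_distrib_left)
  finally show ?thesis
    by (simp add: *[symmetric])
qed

lemma word_pdot: "mon {#a#} \<odot> f = push (\<lambda>w. {#a#} \<cdot> w) f"
  by (simp add: pdot_def push_def)

lemma pdot_word: "f \<odot> mon {#b#} = push (\<lambda>w. w \<cdot> {#b#}) f"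
  by (simp add: pdot_def push_def)

lemma word_pdot_ctx: "mon {#a#} \<odot> f = push (ctx a [] {#}) f"
  by (simp add: word_pdot mdot_word_left ctx_def[abs_def])

lemma pdot_word_ctx: "f \<odot> mon {#b#} = push (ctx [] b {#}) f"
  by (simp add: pdot_word mdot_word_right ctx_def[abs_def])

lemma psandwich_eq_push: "psandwich a f b = push (ctx a b {#}) f"
  by (simp add: word_pdot pdot_word push_push msandwich_eq_ctx)

lemma push_ctx_times_mon: "push (ctx a b u) f * mon v = push (ctx a b (u + v)) f"
  by (simp add: times_mon push_push ctx_def[abs_def] add.assoc)

lemma push_ctx_push_ctx:
  "push (ctx a b u) (push (ctx a' b' u') f) = push (ctx (a @ a') (b' @ b) (ctx a b u u')) f"
  by (simp add: push_push ctx_ctx)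

lemma push_ctx_Nil: "push (ctx [] [] {#}) f = f"
  using push_ident[of f] by (simp add: ctx_def[abs_def])

lemma krig_0 [simp]: "0 \<in> krig X"
  by (simp add: krig_def)

lemma krig_add: "f \<in> krig X \<Longrightarrow> g \<in> krig X \<Longrightarrow> f + g \<in> krig X"
  using keys_add[of f g] by (auto simp: krig_def)

lemma krig_scale: "f \<in> krig X \<Longrightarrow> scale c f \<in> krig X"
  using keys_scale[of c f] by (auto simp: krig_def)

lemma krig_diff: "f \<in> krig X \<Longrightarrow> g \<in> krig X \<Longrightarrow> f - g \<in> krig X"
  by (simp add: diff_eq_scale krig_add krig_scale)

lemma krig_push_ctx:
  "a \<in> lists X \<Longrightarrow> b \<in> lists X \<Longrightarrow> u \<in> rig X \<Longrightarrow> f \<in> krig X \<Longrightarrow> push (ctx a b u) f \<in> krig X"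
  by (auto simp: krig_def keys_push inj_ctx intro!: ctx_in_rig)

lemma rig_idealD:
  assumes "rig_ideal X I"
  shows rig_ideal_krig: "f \<in> I \<Longrightarrow> f \<in> krig X"
    and rig_ideal_0: "0 \<in> I"
    and rig_ideal_add: "f \<in> I \<Longrightarrow> g \<in> I \<Longrightarrow> f + g \<in> I"
    and rig_ideal_scale: "f \<in> I \<Longrightarrow> scale c f \<in> I"
  using assms by (auto simp: rig_ideal_def)

lemma rig_ideal_push_ctx:
  fixes I :: "('x, 'k::field) rpoly set"
  assumes "rig_ideal X I" "a \<in> lists X" "b \<in> lists X" "u \<in> rig X" "f \<in> I"
  shows "push (ctx a b u) f \<in> I"
proof -
  have "psandwich a f b \<in> I"
    using assms unfolding rig_ideal_def by blast
  moreover have "mon u \<in> (krig X :: ('x, 'k) rpoly set)"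
    using assms by (simp add: krig_def)
  ultimately have "psandwich a f b * mon u \<in> I"
    using assms unfolding rig_ideal_def by blast
  then show ?thesis
    by (simp add: psandwich_eq_push push_ctx_times_mon)
qed

lemma rig_ideal_diff: "rig_ideal X I \<Longrightarrow> f \<in> I \<Longrightarrow> g \<in> I \<Longrightarrow> f - g \<in> I"
  by (simp add: diff_eq_scale rig_ideal_add rig_ideal_scale)


section \<open>Monomial orderings and leading monomials\<close>

lemma subst_word_Some_append:
  "subst_word (map Some a @ q) s = image_mset (\<lambda>p. a @ p) (subst_word q s)"
  by (induction a) (auto simp: mdot_word_left multiset.map_comp comp_def)

lemma subst_word_Some: "subst_word (map Some a) s = {#a#}"
  using subst_word_Some_append[of a "[]" s] by simp

text \<open>
  Contexts are substitutions into \<open>\<star>\<close>-monomials, so that the defining property of monomial orderings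
  applies to them (\<open>ctx_strict_mono\<close>).
\<close>

lemma star_subst_ctx:
  "star_subst ({#map Some a @ None # map Some b#} + image_mset (map Some) u) w = ctx a b u w"
proof -
  have "(\<Sum>p\<in>#image_mset (map Some) u. subst_word p w) = u"
    by (induction u) (auto simp: subst_word_Some)
  then show ?thesis
    by (simp add: star_subst_def subst_word_Some_append subst_word_Some ctx_def mdot_word_right
        multiset.map_comp comp_def)
qed

lemma star_mono_ctx:
  assumes "a \<in> lists X" "b \<in> lists X" "u \<in> rig X"
  shows "star_mono X ({#map Some a @ None # map Some b#} + image_mset (map Some) u)"
proof -
  have c: "count_list (map Some p) None = 0" for p :: "'a list"
    by (induction p) auto
  have "(\<Sum>p\<in>#image_mset (map Some) u. count_list p None) = 0"
    by (simp add: c)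
  then show ?thesis
    using assms by (fastforce simp: star_mono_def rig_def c)
qed

locale ordered_rig =
  fixes X :: "'x set" and r :: "'x mono rel"
  assumes ordering: "monomial_ordering X r"
begin

abbreviation prec :: "'x mono \<Rightarrow> 'x mono \<Rightarrow> bool" (infix \<open>\<prec>\<close> 50) where
  "v \<prec> w \<equiv> less_in r v w"

abbreviation preceq :: "'x mono \<Rightarrow> 'x mono \<Rightarrow> bool" (infix \<open>\<preceq>\<close> 50) where
  "v \<preceq> w \<equiv> (v, w) \<in> r"

lemma well_order: "well_order_on (rig X) r"
  using ordering by (simp add: monomial_ordering_def)

lemma preceq_refl: "v \<in> rig X \<Longrightarrow> v \<preceq> v"
  using well_order by (simp add: order_on_defs refl_on_def)

lemma preceq_trans: "u \<preceq> v \<Longrightarrow> v \<preceq> w \<Longrightarrow> u \<preceq> w"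
  using well_order unfolding order_on_defs trans_def by blast

lemma preceq_antisym: "u \<preceq> v \<Longrightarrow> v \<preceq> u \<Longrightarrow> u = v"
  using well_order unfolding order_on_defs antisym_def by blast

lemma preceq_total: "u \<in> rig X \<Longrightarrow> v \<in> rig X \<Longrightarrow> u \<preceq> v \<or> v \<preceq> u"
  using well_order unfolding order_on_defs total_on_def refl_on_def by metis

lemma preceq_prec_trans: "u \<preceq> v \<Longrightarrow> v \<prec> w \<Longrightarrow> u \<prec> w"
  using preceq_trans preceq_antisym by blast

lemma mono_induct [consumes 1, case_names less]:
  assumes "w \<in> rig X" "\<And>w. w \<in> rig X \<Longrightarrow> (\<And>v. v \<in> rig X \<Longrightarrow> v \<prec> w \<Longrightarrow> P v) \<Longrightarrow> P w"
  shows "P w"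
proof -
  have "wf (r - Id)"
    using well_order by (simp add: well_order_on_def)
  then have "w \<in> rig X \<longrightarrow> P w"
    by (induction w rule: wf_induct_rule) (use assms(2) in auto)
  then show ?thesis
    using assms(1) by blast
qed

lemma ctx_strict_mono:
  assumes "a \<in> lists X" "b \<in> lists X" "u \<in> rig X" "v \<in> rig X" "w \<in> rig X" "v \<prec> w"
  shows "ctx a b u v \<prec> ctx a b u w"
  using ordering star_mono_ctx[OF assms(1-3)] assms(4-6)
  unfolding monomial_ordering_def by (metis star_subst_ctx)

text \<open>
  A strictly increasing map of a well-ordered set into itself never decreases an element: if it
  moved \<open>w\<close> down, it would also move down its value at \<open>w\<close>, which is smaller, and so on for ever.
\<close>

lemma preceq_ctx:
  assumes "a \<in> lists X" "b \<in> lists X" "u \<in> rig X" "w \<in> rig X"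
  shows "w \<preceq> ctx a b u w"
  using assms(4)
proof (induction w rule: mono_induct)
  case (less w)
  have "ctx a b u w \<in> rig X"
    using assms less by (simp add: ctx_in_rig)
  then show ?case
    using less ctx_strict_mono[OF assms(1-3)] preceq_total preceq_antisym by metis
qed

lemma preceq_if_divides: "divides_in X v w \<Longrightarrow> v \<in> rig X \<Longrightarrow> v \<preceq> w"
  unfolding divides_in_def using preceq_ctx by blast

lemma ctx_mono_plus:
  assumes "u \<in> rig X" "v \<in> rig X" "w \<in> rig X" "v \<prec> w"
  shows "u + v \<prec> u + w"
  using ctx_strict_mono[of "[]" "[]" u v w] assms by (simp add: add.commute)

lemma lm_eqI:
  assumes "w \<in> Poly_Mapping.keys f" "\<And>v. v \<in> Poly_Mapping.keys f \<Longrightarrow> v \<preceq> w"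
  shows "lm r f = w"
  unfolding lm_def using assms by (intro the_equality) (auto intro: preceq_antisym)

lemma ex_max:
  assumes "finite A" "A \<noteq> {}" "A \<subseteq> rig X"
  shows "\<exists>w\<in>A. \<forall>v\<in>A. v \<preceq> w"
  using assms
proof (induction A rule: finite_ne_induct)
  case (singleton x)
  then show ?case by (simp add: preceq_refl)
next
  case (insert x A)
  then obtain w where w: "w \<in> A" "\<forall>v\<in>A. v \<preceq> w"
    by auto
  show ?case
  proof (cases "x \<preceq> w")
    case True
    then show ?thesis using w by auto
  next
    case False
    then have "w \<preceq> x"
      using preceq_total insert.prems w by blast
    then show ?thesis
      using w insert.prems by (auto intro: preceq_trans preceq_refl)
  qed
qed

lemma lm_max:
  assumes "f \<in> krig X" "f \<noteq> 0"
  shows "lm r f \<in> Poly_Mapping.keys f" "\<And>v. v \<in> Poly_Mapping.keys f \<Longrightarrow> v \<preceq> lm r f"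
proof -
  obtain w where w: "w \<in> Poly_Mapping.keys f" "\<forall>v\<in>Poly_Mapping.keys f. v \<preceq> w"
    using ex_max[of "Poly_Mapping.keys f"] assms by (auto simp: krig_def)
  then have "lm r f = w"
    by (intro lm_eqI) auto
  then show "lm r f \<in> Poly_Mapping.keys f" "\<And>v. v \<in> Poly_Mapping.keys f \<Longrightarrow> v \<preceq> lm r f"
    using w by auto
qed

lemma lm_in_rig: "f \<in> krig X \<Longrightarrow> f \<noteq> 0 \<Longrightarrow> lm r f \<in> rig X"
  using lm_max(1) by (auto simp: krig_def)

lemma monicD:
  assumes "monic r f" "f \<in> krig X"
  shows "f \<noteq> 0" "lm r f \<in> rig X" "Poly_Mapping.lookup f (lm r f) = 1"
  using assms lm_in_rig by (auto simp: monic_def)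

lemma lm_push_ctx:
  assumes "a \<in> lists X" "b \<in> lists X" "u \<in> rig X" "f \<in> krig X" "f \<noteq> 0"
  shows "lm r (push (ctx a b u) f) = ctx a b u (lm r f)"
proof (rule lm_eqI)
  show "ctx a b u (lm r f) \<in> Poly_Mapping.keys (push (ctx a b u) f)"
    using lm_max(1)[OF assms(4,5)] by (simp add: keys_push inj_ctx)
  fix v assume "v \<in> Poly_Mapping.keys (push (ctx a b u) f)"
  then obtain v' where v': "v' \<in> Poly_Mapping.keys f" "v = ctx a b u v'"
    by (auto simp: keys_push inj_ctx)
  moreover from this have "v' \<preceq> lm r f" "v' \<in> rig X"
    using assms lm_max by (auto simp: krig_def)
  ultimately show "v \<preceq> ctx a b u (lm r f)"
    using ctx_strict_mono assms lm_in_rig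
    by (metis ctx_in_rig preceq_refl)
qed

lemma keys_push_ctx_preceq:
  assumes "a \<in> lists X" "b \<in> lists X" "u \<in> rig X" "f \<in> krig X"
    and "v \<in> Poly_Mapping.keys (push (ctx a b u) f)"
  shows "v \<preceq> ctx a b u (lm r f)"
proof -
  have "f \<noteq> 0" "push (ctx a b u) f \<noteq> 0"
    using assms by auto
  then show ?thesis
    using lm_max(2)[OF krig_push_ctx] assms lm_push_ctx by metis
qed

text \<open>
  Cancellation of the leading terms: if two polynomials are bounded by \<open>w\<close> and have the same
  coefficient there, their difference stays strictly below \<open>w\<close>.
\<close>

lemma keys_diff_prec:
  assumes "\<And>v. v \<in> Poly_Mapping.keys f \<Longrightarrow> v \<preceq> w" "\<And>v. v \<in> Poly_Mapping.keys g \<Longrightarrow> v \<preceq> w"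
    and "Poly_Mapping.lookup f w = Poly_Mapping.lookup g w"
    and "v \<in> Poly_Mapping.keys (f - g)"
  shows "v \<prec> w"
  using assms keys_diff[of f g] by (auto simp: in_keys_iff lookup_minus)


section \<open>Linear combinations with bounded leading monomials\<close>

text \<open>
  Linear combinations of polynomials \<open>a s b \<circ> u\<close> with \<open>s \<in> S\<close> whose leading monomials all satisfy \<open>Q\<close>.
  Triviality modulo \<open>(S, w)\<close> is the case \<open>v \<prec> w\<close> (\<open>trivial_mod_iff_comb\<close>), and without a restriction
  one obtains the ideal generated by \<open>S\<close> (\<open>generated_ideal_eq_comb\<close>).
\<close>

inductive comb :: "('x, 'k::field) rpoly set \<Rightarrow> ('x mono \<Rightarrow> bool) \<Rightarrow> ('x, 'k) rpoly \<Rightarrow> bool"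
  for S :: "('x, 'k::field) rpoly set" and Q :: "'x mono \<Rightarrow> bool"
where
  zero: "comb S Q 0"
| step: "comb S Q (scale c (push (ctx a b u) s) + h)"
    if "a \<in> lists X" "b \<in> lists X" "u \<in> rig X" "s \<in> S" "Q (ctx a b u (lm r s))" "comb S Q h"

lemma comb_term:
  "a \<in> lists X \<Longrightarrow> b \<in> lists X \<Longrightarrow> u \<in> rig X \<Longrightarrow> s \<in> S \<Longrightarrow> Q (ctx a b u (lm r s)) \<Longrightarrow>
   comb S Q (push (ctx a b u) s)"
  using comb.step[OF _ _ _ _ _ comb.zero, of a b u s S Q 1] by simp

lemma comb_add: "comb S Q f \<Longrightarrow> comb S Q g \<Longrightarrow> comb S Q (f + g)"
  by (induction f rule: comb.induct) (auto simp: add.assoc intro: comb.step)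

lemma comb_scale: "comb S Q f \<Longrightarrow> comb S Q (scale c f)"
  by (induction f rule: comb.induct) (auto simp: scale_add intro: comb.intros)

lemma comb_diff: "comb S Q f \<Longrightarrow> comb S Q g \<Longrightarrow> comb S Q (f - g)"
  by (simp add: diff_eq_scale comb_add comb_scale)

lemma comb_sum: "(\<And>i. i \<in> A \<Longrightarrow> comb S Q (h i)) \<Longrightarrow> comb S Q (sum h A)"
  by (induction A rule: infinite_finite_induct) (auto intro: comb.zero comb_add)

lemma comb_mono: "comb S Q f \<Longrightarrow> (\<And>v. Q v \<Longrightarrow> Q' v) \<Longrightarrow> comb S Q' f"
  by (induction f rule: comb.induct) (auto intro: comb.intros)

lemma comb_in_ideal: "comb S Q f \<Longrightarrow> rig_ideal X I \<Longrightarrow> S \<subseteq> I \<Longrightarrow> f \<in> I"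
proof (induction f rule: comb.induct)
  case (step a b u s h c)
  then show ?case
    by (intro rig_ideal_add rig_ideal_scale rig_ideal_push_ctx) auto
qed (simp add: rig_ideal_0)

lemma comb_push_ctx:
  assumes "comb S Q f" "a \<in> lists X" "b \<in> lists X" "u \<in> rig X"
    and "\<And>a' b' u' s. a' \<in> lists X \<Longrightarrow> b' \<in> lists X \<Longrightarrow> u' \<in> rig X \<Longrightarrow> s \<in> S \<Longrightarrow>
          Q (ctx a' b' u' (lm r s)) \<Longrightarrow> Q' (ctx a b u (ctx a' b' u' (lm r s)))"
  shows "comb S Q' (push (ctx a b u) f)"
  using assms(1)
proof (induction f rule: comb.induct)
  case zero
  then show ?case by (simp add: comb.zero)
next
  case (step a' b' u' s h c)
  have "comb S Q' (push (ctx (a @ a') (b' @ b) (ctx a b u u')) s)"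
    using step assms by (intro comb_term) (auto simp: ctx_in_rig simp flip: ctx_ctx)
  then show ?case
    using step by (simp add: push_add push_scale push_ctx_push_ctx comb_add comb_scale)
qed

lemma comb_push_ctx_prec:
  assumes "comb S (\<lambda>v. v \<prec> w) f" "a \<in> lists X" "b \<in> lists X" "u \<in> rig X"
    and "w \<in> rig X" "\<And>s. s \<in> S \<Longrightarrow> lm r s \<in> rig X"
  shows "comb S (\<lambda>v. v \<prec> ctx a b u w) (push (ctx a b u) f)"
  using assms(1-4)
proof (rule comb_push_ctx)
  fix a' b' u' s
  assume *: "a' \<in> lists X" "b' \<in> lists X" "u' \<in> rig X" "s \<in> S" "ctx a' b' u' (lm r s) \<prec> w"
  show "ctx a b u (ctx a' b' u' (lm r s)) \<prec> ctx a b u w"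
    by (rule ctx_strict_mono[OF assms(2-4) _ assms(5) *(5)]) (use assms * in \<open>auto intro!: ctx_in_rig\<close>)
qed

lemma comb_krig: "comb S Q f \<Longrightarrow> S \<subseteq> krig X \<Longrightarrow> f \<in> krig X"
  by (induction f rule: comb.induct) (auto intro!: krig_add krig_scale krig_push_ctx)

lemma comb_keys:
  assumes "comb S (\<lambda>v. v \<prec> w) f" "S \<subseteq> krig X" "v \<in> Poly_Mapping.keys f"
  shows "v \<prec> w"
  using assms
proof (induction f arbitrary: v rule: comb.induct)
  case (step a b u s h c)
  have "v \<in> Poly_Mapping.keys (push (ctx a b u) s) \<or> v \<in> Poly_Mapping.keys h"
    using step.prems(2) keys_add[of "scale c (push (ctx a b u) s)" h] keys_scale[of c "push (ctx a b u) s"]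
    by blast
  then show ?case
  proof
    assume "v \<in> Poly_Mapping.keys (push (ctx a b u) s)"
    then have "v \<preceq> ctx a b u (lm r s)"
      using keys_push_ctx_preceq step by blast
    then show ?case
      using step.hyps(5) by (rule preceq_prec_trans)
  qed (use step in blast)
qed simp

lemma generated_ideal_eq_comb:
  assumes "S \<subseteq> krig X"
  shows "generated_ideal X S = {f. comb S (\<lambda>_. True) f}"
proof
  have "comb S (\<lambda>_. True) (f * g)" if f: "comb S (\<lambda>_. True) f" and g: "g \<in> krig X" for f g
  proof -
    have "comb S (\<lambda>_. True) (f * mon v)" if "v \<in> Poly_Mapping.keys g" for v
    proof -
      have "comb S (\<lambda>_. True) (push (ctx [] [] v) f)"
        using f by (rule comb_push_ctx) (use that g in \<open>auto simp: krig_def\<close>)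
      then show ?thesis
        by (simp add: times_mon_ctx)
    qed
    then show ?thesis
      unfolding times_expand[of f g] by (intro comb_sum comb_scale)
  qed
  moreover have "comb S (\<lambda>_. True) (mon {#a#} \<odot> f)" "comb S (\<lambda>_. True) (f \<odot> mon {#a#})"
    if "comb S (\<lambda>_. True) f" "a \<in> lists X" for f a
    unfolding word_pdot_ctx pdot_word_ctx using that by (auto intro: comb_push_ctx)
  ultimately have "rig_ideal X {f. comb S (\<lambda>_. True) f}"
    using assms unfolding rig_ideal_def
    by (auto intro: comb.zero comb_add comb_scale comb_krig)
  moreover have "S \<subseteq> {f. comb S (\<lambda>_. True) f}"
    using comb_term[of "[]" "[]" "{#}" _ S "\<lambda>_. True"] by (auto simp: push_ctx_Nil)
  ultimately show "generated_ideal X S \<subseteq> {f. comb S (\<lambda>_. True) f}"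
    unfolding generated_ideal_def by blast
  show "{f. comb S (\<lambda>_. True) f} \<subseteq> generated_ideal X S"
    unfolding generated_ideal_def using comb_in_ideal by blast
qed

lemma trivial_mod_iff_comb: "trivial_mod X r S w h \<longleftrightarrow> comb S (\<lambda>v. v \<prec> w) h"
proof
  assume "trivial_mod X r S w h"
  then show "comb S (\<lambda>v. v \<prec> w) h"
    unfolding trivial_mod_def psandwich_eq_push push_ctx_times_mon msandwich_eq_ctx ctx_plus
    by (auto intro!: comb_sum comb_scale comb_term)
next
  assume "comb S (\<lambda>v. v \<prec> w) h"
  then show "trivial_mod X r S w h"
  proof (induction h rule: comb.induct)
    case zero
    show ?case
      unfolding trivial_mod_def by (rule exI[of _ 0]) simp
  next
    case (step a b u s h c)
    then obtain n :: nat and \<alpha> a' s' b' u' where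
      *: "\<forall>i<n. a' i \<in> lists X \<and> b' i \<in> lists X \<and> u' i \<in> rig X \<and> s' i \<in> S \<and>
               msandwich (a' i) (lm r (s' i)) (b' i) + u' i \<prec> w"
      "h = (\<Sum>i<n. scale (\<alpha> i) (psandwich (a' i) (s' i) (b' i) * mon (u' i)))"
      unfolding trivial_mod_def by blast
    have t: "psandwich a s b * mon u = push (ctx a b u) s"
      "msandwich a (lm r s) b + u = ctx a b u (lm r s)"
      by (simp_all add: psandwich_eq_push push_ctx_times_mon msandwich_eq_ctx ctx_plus)
    show ?case
      unfolding trivial_mod_def
      by (rule exI[of _ "Suc n"], rule exI[of _ "\<alpha>(n := c)"], rule exI[of _ "a'(n := a)"],
          rule exI[of _ "s'(n := s)"], rule exI[of _ "b'(n := b)"], rule exI[of _ "u'(n := u)"])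
        (use * step t in \<open>auto simp: less_Suc_eq add.commute\<close>)
  qed
qed


section \<open>The composition-diamond lemma\<close>

lemma gs_basisD:
  assumes "gs_basis X r S" "s \<in> S"
  shows "s \<in> krig X" "monic r s" "s \<noteq> 0" "lm r s \<in> rig X" "Poly_Mapping.lookup s (lm r s) = 1"
proof -
  show "s \<in> krig X" "monic r s"
    using assms unfolding gs_basis_def by auto
  then show "s \<noteq> 0" "lm r s \<in> rig X" "Poly_Mapping.lookup s (lm r s) = 1"
    using monicD by blast+
qed

text \<open>
  Multiplying \<open>a s b \<circ> c\<close> by a polynomial \<open>g\<close> below \<open>q\<close> gives terms below \<open>a \<cdot> lm s \<cdot> b \<circ> c \<circ> q\<close>, because each
  monomial of \<open>g\<close> contributes one context.
\<close>

lemma comb_times_prec: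
  assumes S: "s \<in> S" "lm r s \<in> rig X" and ctx: "a \<in> lists X" "b \<in> lists X" "c \<in> rig X"
    and q: "q \<in> rig X" and g: "g \<in> krig X" "\<And>v. v \<in> Poly_Mapping.keys g \<Longrightarrow> v \<prec> q"
  shows "comb S (\<lambda>v. v \<prec> ctx a b (c + q) (lm r s)) (push (ctx a b c) s * g)"
proof -
  have "comb S (\<lambda>v. v \<prec> ctx a b (c + q) (lm r s)) (push (ctx a b c) s * mon v)"
    if v: "v \<in> Poly_Mapping.keys g" for v
  proof -
    have vr: "v \<in> rig X"
      using v g by (auto simp: krig_def)
    have "ctx a b c (lm r s) + v \<prec> ctx a b c (lm r s) + q"
      using vr q g(2)[OF v] S ctx by (intro ctx_mono_plus ctx_in_rig) auto
    then have "ctx a b (c + v) (lm r s) \<prec> ctx a b (c + q) (lm r s)"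
      by (simp add: ctx_def add.assoc)
    then show ?thesis
      using S ctx vr by (auto simp: push_ctx_times_mon intro!: comb_term)
  qed
  then show ?thesis
    unfolding times_expand[of _ g] by (intro comb_sum comb_scale)
qed

text \<open>
  With \<open>F = a f b\<close> and \<open>G = a' g b'\<close>, whose leading monomials are \<open>p\<close> and \<open>q\<close>, commutativity of \<open>\<circ>\<close> gives
  \<open>F \<circ> q - G \<circ> p = G \<circ> (F - p) - F \<circ> (G - q)\<close>, and the tails \<open>F - p\<close>, \<open>G - q\<close> lie strictly below \<open>p\<close> and
  \<open>q\<close>. So terms whose leading words do not interact never need a composition.
\<close>

lemma comb_disjoint:
  fixes S :: "('x, 'k::field) rpoly set"
  assumes gs: "gs_basis X r S" and fg: "f \<in> S" "g \<in> S"
    and X: "a \<in> lists X" "b \<in> lists X" "a' \<in> lists X" "b' \<in> lists X" "c \<in> rig X"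
    and p: "p = ctx a b {#} (lm r f)" and q: "q = ctx a' b' {#} (lm r g)"
  shows "comb S (\<lambda>v. v \<prec> p + q + c) (push (ctx a b (q + c)) f - push (ctx a' b' (p + c)) g)"
proof -
  note D = gs_basisD[OF gs]
  define F where "F = push (ctx a b {#}) f"
  define G where "G = push (ctx a' b' {#}) g"
  have rig: "p \<in> rig X" "q \<in> rig X" and krig: "F \<in> krig X" "G \<in> krig X"
    using D fg X by (auto simp: p q F_def G_def intro!: ctx_in_rig krig_push_ctx)
  have lead: "Poly_Mapping.lookup F p = 1" "Poly_Mapping.lookup G q = 1"
    using D fg by (simp_all add: F_def G_def p q lookup_push inj_ctx)
  have le: "v \<preceq> p" if "v \<in> Poly_Mapping.keys F" for v
    using keys_push_ctx_preceq[of a b "{#}" f v] that X D fg by (auto simp: F_def p)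
  have le': "v \<preceq> q" if "v \<in> Poly_Mapping.keys G" for v
    using keys_push_ctx_preceq[of a' b' "{#}" g v] that X D fg by (auto simp: G_def q)
  have tail: "v \<prec> p" if "v \<in> Poly_Mapping.keys (F - mon p)" for v
    by (rule keys_diff_prec[OF _ _ _ that]) (use le lead rig in \<open>auto simp: preceq_refl\<close>)
  have tail': "v \<prec> q" if "v \<in> Poly_Mapping.keys (G - mon q)" for v
    by (rule keys_diff_prec[OF _ _ _ that]) (use le' lead rig in \<open>auto simp: preceq_refl\<close>)
  have mon: "mon p \<in> (krig X :: ('x, 'k) rpoly set)" "mon q \<in> (krig X :: ('x, 'k) rpoly set)"
    using rig by (auto simp: krig_def)
  have FG: "comb S (\<lambda>v. v \<prec> ctx a b (c + q) (lm r f)) (push (ctx a b c) f * (G - mon q))"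
    by (rule comb_times_prec) (use fg D X rig krig mon tail' in \<open>auto intro!: krig_diff\<close>)
  have GF: "comb S (\<lambda>v. v \<prec> ctx a' b' (c + p) (lm r g)) (push (ctx a' b' c) g * (F - mon p))"
    by (rule comb_times_prec) (use fg D X rig krig mon tail in \<open>auto intro!: krig_diff\<close>)
  have w: "ctx a b (c + q) (lm r f) = p + q + c" "ctx a' b' (c + p) (lm r g) = p + q + c"
    by (simp_all add: p q ctx_def ac_simps)
  have "comb S (\<lambda>v. v \<prec> p + q + c)
      (push (ctx a' b' c) g * (F - mon p) - push (ctx a b c) f * (G - mon q))"
    by (rule comb_diff[OF GF[unfolded w] FG[unfolded w]])
  moreover have "push (ctx a' b' c) g = G * mon c" "push (ctx a b c) f = F * mon c"
    by (simp_all add: F_def G_def push_ctx_times_mon)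
  moreover have "push (ctx a b (q + c)) f = F * mon c * mon q" "push (ctx a' b' (p + c)) g = G * mon c * mon p"
    by (simp_all add: F_def G_def push_ctx_times_mon add.commute)
  ultimately show ?thesis
    by (simp add: algebra_simps)
qed

text \<open>
  Two terms with leading monomial \<open>w\<close> and common outer factors \<open>a\<close>, \<open>b\<close> arise from the least common
  multiple of their inner parts \<open>p\<close>, \<open>q\<close> by the context \<open>a \<cdot> _ \<cdot> b \<circ> c\<close>, where \<open>c\<close> is what \<open>w\<close> contains in excess
  of that multiple. Since contexts are strictly increasing, they preserve triviality.
\<close>

lemma comb_overlap:
  assumes gs: "gs_basis X r S" and fg: "f \<in> S" "g \<in> S"
    and X: "a1 \<in> lists X" "b1 \<in> lists X" "a2 \<in> lists X" "b2 \<in> lists X" "a \<in> lists X" "b \<in> lists X"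
      "u1 \<in> rig X" "u2 \<in> rig X"
    and p: "p = ctx a1 b1 {#} (lm r f)" and q: "q = ctx a2 b2 {#} (lm r g)"
    and w: "w = ctx (a @ a1) (b1 @ b) u1 (lm r f)" "w = ctx (a @ a2) (b2 @ b) u2 (lm r g)"
    and cmp: "comb S (\<lambda>v. v \<prec> lcm_circ p q) (push (ctx a1 b1 (q - p)) f - push (ctx a2 b2 (p - q)) g)"
  shows "comb S (\<lambda>v. v \<prec> w) (push (ctx (a @ a1) (b1 @ b) u1) f - push (ctx (a @ a2) (b2 @ b) u2) g)"
proof -
  note D = gs_basisD[OF gs]
  define P where "P = ctx a b {#} p"
  define Q where "Q = ctx a b {#} q"
  have wP: "w = P + u1" "w = Q + u2"
    using w by (simp_all add: P_def Q_def p q ctx_ctx, simp_all add: ctx_def)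
  define c where "c = w - lcm_circ P Q"
  have u1: "u1 = (Q - P) + c" and u2: "u2 = (P - Q) + c"
  proof -
    have "count u1 x = count ((Q - P) + c) x \<and> count u2 x = count ((P - Q) + c) x" for x
    proof -
      have "count P x + count u1 x = count Q x + count u2 x"
        using wP by (metis count_union)
      then show ?thesis
        by (auto simp: c_def wP(1) lcm_circ_left)
    qed
    then show "u1 = (Q - P) + c" "u2 = (P - Q) + c"
      by (auto intro: multiset_eqI)
  qed
  have c: "c \<in> rig X"
    using X(7) by (simp add: u1)
  have rig: "p \<in> rig X" "q \<in> rig X"
    using D fg X by (auto simp: p q intro!: ctx_in_rig)
  have "w = ctx a b c (lcm_circ p q)"
    using wP(1) u1 unfolding lcm_circ_left
    by (simp add: ctx_def P_def Q_def image_mset_diff_ctx add.assoc)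
  moreover have "comb S (\<lambda>v. v \<prec> ctx a b c (lcm_circ p q))
      (push (ctx a b c) (push (ctx a1 b1 (q - p)) f - push (ctx a2 b2 (p - q)) g))"
    using cmp by (rule comb_push_ctx_prec) (use X c rig D in \<open>auto simp: lcm_circ_left rig_diff\<close>)
  moreover have "ctx a b c (q - p) = u1" "ctx a b c (p - q) = u2"
    by (simp_all add: u1 u2 P_def Q_def ctx_def image_mset_diff_ctx)
  ultimately show ?thesis
    by (simp add: push_diff push_ctx_push_ctx)
qed

lemma comb_composition1:
  assumes gs: "gs_basis X r S" and fg: "f \<in> S" "g \<in> S"
    and X: "a \<in> lists X" "b \<in> lists X"
    and p: "p = ctx [] a {#} (lm r f)" and q: "q = ctx b [] {#} (lm r g)"
    and ov: "p \<inter># q \<noteq> {#}"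
  shows "comb S (\<lambda>v. v \<prec> lcm_circ p q) (push (ctx [] a (q - p)) f - push (ctx b [] (p - q)) g)"
proof -
  have "p = lm r f \<cdot> {#a#}" "q = {#b#} \<cdot> lm r g"
    by (simp_all add: p q ctx_def mdot_word_left mdot_word_right)
  moreover have "push (ctx [] a (q - p)) f = (f \<odot> mon {#a#}) * mon (q - p)"
    "push (ctx b [] (p - q)) g = (mon {#b#} \<odot> g) * mon (p - q)"
    by (simp_all add: word_pdot_ctx pdot_word_ctx push_ctx_times_mon)
  ultimately have "composition1 X r f g (lcm_circ p q)
      (push (ctx [] a (q - p)) f - push (ctx b [] (p - q)) g)"
    unfolding composition1_def Let_def using X size_lcm_circ_less[OF ov]
    by (metis lcm_circ_left lcm_circ_right)
  then show ?thesis
    using gs fg unfolding gs_basis_def trivial_mod_iff_comb by blast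
qed

lemma comb_composition2:
  assumes gs: "gs_basis X r S" and fg: "f \<in> S" "g \<in> S"
    and X: "a \<in> lists X" "b \<in> lists X"
    and p: "p = ctx [] [] {#} (lm r f)" and q: "q = ctx a b {#} (lm r g)"
    and ov: "p \<inter># q \<noteq> {#}"
  shows "comb S (\<lambda>v. v \<prec> lcm_circ p q) (push (ctx [] [] (q - p)) f - push (ctx a b (p - q)) g)"
proof -
  have "p = lm r f" "q = msandwich a (lm r g) b"
    by (simp_all add: p q msandwich_eq_ctx)
  moreover have "push (ctx [] [] (q - p)) f = f * mon (q - p)"
    "push (ctx a b (p - q)) g = psandwich a g b * mon (p - q)"
    by (simp only: times_mon_ctx) (simp add: psandwich_eq_push push_ctx_times_mon)
  ultimately have "composition2 X r f g (lcm_circ p q)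
      (push (ctx [] [] (q - p)) f - push (ctx a b (p - q)) g)"
    unfolding composition2_def Let_def using X size_lcm_circ_less[OF ov]
    by (metis lcm_circ_left lcm_circ_right)
  then show ?thesis
    using gs fg unfolding gs_basis_def trivial_mod_iff_comb by blast
qed

lemma overlap_ctx:
  assumes "a1 @ x @ b1 = a2 @ y @ b2" "x \<in># v" "y \<in># w"
  shows "ctx a1 b1 {#} v \<inter># ctx a2 b2 {#} w \<noteq> {#}"
proof -
  have "a1 @ x @ b1 \<in># ctx a1 b1 {#} v" "a2 @ y @ b2 \<in># ctx a2 b2 {#} w"
    using assms(2,3) by (auto simp: ctx_def)
  then have "a1 @ x @ b1 \<in># ctx a1 b1 {#} v \<inter># ctx a2 b2 {#} w"
    using assms(1) by simp
  then show ?thesis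
    by (metis empty_not_add_mset mset_add)
qed

text \<open>
  Cancel \<open>a1\<close> on the left of the common word. Then \<open>x b1 = a y b2\<close>, and either \<open>b1\<close> is a suffix of \<open>b2\<close>,
  so that a multiple of \<open>lm g\<close> meets \<open>lm f\<close> itself (type II), or \<open>b2\<close> is a suffix of \<open>b1\<close>, so that \<open>f\<close>
  is multiplied on the right and \<open>g\<close> on the left (type I). Any cofactors are admitted in a
  composition, so it does not matter whether \<open>x\<close> and \<open>y\<close> overlap as words.
\<close>

lemma comb_common_word:
  assumes gs: "gs_basis X r S" and fg: "f \<in> S" "g \<in> S"
    and X: "a1 \<in> lists X" "b1 \<in> lists X" "a2 \<in> lists X" "b2 \<in> lists X" "u1 \<in> rig X" "u2 \<in> rig X"
    and w: "w = ctx a1 b1 u1 (lm r f)" "w = ctx a2 b2 u2 (lm r g)"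
    and xy: "x \<in># lm r f" "y \<in># lm r g" "a1 @ x @ b1 = a2 @ y @ b2"
    and prefix: "a2 = a1 @ a"
  shows "comb S (\<lambda>v. v \<prec> w) (push (ctx a1 b1 u1) f - push (ctx a2 b2 u2) g)"
proof -
  have "x @ b1 = (a @ y) @ b2"
    using xy(3) prefix by simp
  then obtain us where "x = (a @ y) @ us \<and> us @ b1 = b2 \<or> x @ us = a @ y \<and> b1 = us @ b2"
    using append_eq_append_conv2[of x b1 "a @ y" b2] by blast
  then consider b where "b2 = b @ b1" "x = a @ y @ b" | b where "b1 = b @ b2" "x @ b = a @ y"
    by fastforce
  then show ?thesis
  proof cases
    case 1
    have X': "a \<in> lists X" "b \<in> lists X"
      using X prefix 1 by auto
    have "comb S (\<lambda>v. v \<prec> w) (push (ctx (a1 @ []) ([] @ b1) u1) f - push (ctx (a1 @ a) (b @ b1) u2) g)"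
    proof (rule comb_overlap[OF gs fg _ _ _ _ _ _ _ _ refl refl])
      show "comb S (\<lambda>v. v \<prec> lcm_circ (ctx [] [] {#} (lm r f)) (ctx a b {#} (lm r g)))
        (push (ctx [] [] (ctx a b {#} (lm r g) - ctx [] [] {#} (lm r f))) f -
         push (ctx a b (ctx [] [] {#} (lm r f) - ctx a b {#} (lm r g))) g)"
        using overlap_ctx[of "[]" x "[]" a y b] xy 1
        by (intro comb_composition2[OF gs fg X' refl refl]) auto
    qed (use X X' w prefix 1 in auto)
    then show ?thesis
      using prefix 1 by simp
  next
    case 2
    have X': "a \<in> lists X" "b \<in> lists X"
      using X prefix 2 by auto
    have "comb S (\<lambda>v. v \<prec> w) (push (ctx (a1 @ []) (b @ b2) u1) f - push (ctx (a1 @ a) ([] @ b2) u2) g)"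
    proof (rule comb_overlap[OF gs fg _ _ _ _ _ _ _ _ refl refl])
      show "comb S (\<lambda>v. v \<prec> lcm_circ (ctx [] b {#} (lm r f)) (ctx a [] {#} (lm r g)))
        (push (ctx [] b (ctx a [] {#} (lm r g) - ctx [] b {#} (lm r f))) f -
         push (ctx a [] (ctx [] b {#} (lm r f) - ctx a [] {#} (lm r g))) g)"
        using overlap_ctx[of "[]" x b a y "[]"] xy 2
        by (intro comb_composition1[OF gs fg X'(2,1) refl refl]) auto
    qed (use X X' w prefix 2 in auto)
    then show ?thesis
      using prefix 2 by simp
  qed
qed

lemma comb_same_lead:
  assumes gs: "gs_basis X r S" and fg: "f \<in> S" "g \<in> S"
    and X: "a1 \<in> lists X" "b1 \<in> lists X" "a2 \<in> lists X" "b2 \<in> lists X" "u1 \<in> rig X" "u2 \<in> rig X"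
    and w: "w = ctx a1 b1 u1 (lm r f)" "w = ctx a2 b2 u2 (lm r g)"
  shows "comb S (\<lambda>v. v \<prec> w) (push (ctx a1 b1 u1) f - push (ctx a2 b2 u2) g)"
proof -
  define p where "p = ctx a1 b1 {#} (lm r f)"
  define q where "q = ctx a2 b2 {#} (lm r g)"
  have wpq: "w = p + u1" "w = q + u2"
    by (simp_all add: w(1) p_def ctx_plus) (simp add: w(2) q_def ctx_plus flip: w(1))
  show ?thesis
  proof (cases "p \<inter># q = {#}")
    case True
    \<comment> \<open>Disjoint divisors of \<open>w\<close> leave room for their product, and \<open>c\<close> is the cofactor.\<close>
    define c where "c = w - (p + q)"
    have c: "u1 = q + c \<and> u2 = p + c"
    proof -
      have "count u1 x = count (q + c) x \<and> count u2 x = count (p + c) x" for x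
      proof -
        have "count p x + count u1 x = count q x + count u2 x"
          using wpq by (metis count_union)
        moreover have "min (count p x) (count q x) = 0"
          using True by (metis count_empty count_inter_mset)
        ultimately show ?thesis
          by (auto simp: c_def wpq(1) min_def split: if_splits)
      qed
      then show ?thesis
        by (auto intro: multiset_eqI)
    qed
    then have "w = p + q + c"
      using wpq by (simp add: add.assoc)
    moreover have "c \<in> rig X"
      using c X by auto
    ultimately show ?thesis
      using comb_disjoint[OF gs fg X(1-4) _ p_def q_def] c by simp
  next
    case False
    then obtain z where "z \<in># p" "z \<in># q"
      by (metis inter_iff multiset_nonemptyE)
    then obtain x y where xy: "x \<in># lm r f" "y \<in># lm r g" "a1 @ x @ b1 = a2 @ y @ b2"
      by (auto simp: p_def q_def ctx_def)
    then consider a where "a2 = a1 @ a" | a where "a1 = a2 @ a"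
      using append_eq_append_conv2[of a1 "x @ b1" a2 "y @ b2"] by blast
    then show ?thesis
    proof cases
      case 1
      then show ?thesis
        using comb_common_word[OF gs fg X w xy] by blast
    next
      case (2 a)
      \<comment> \<open>Exchange \<open>f\<close> and \<open>g\<close>; the difference only changes its sign.\<close>
      then have "comb S (\<lambda>v. v \<prec> w) (push (ctx a2 b2 u2) g - push (ctx a1 b1 u1) f)"
        using comb_common_word[OF gs fg(2,1) X(3,4,1,2,6,5) w(2,1) xy(2,1) xy(3)[symmetric]] by blast
      then have "comb S (\<lambda>v. v \<prec> w) (scale (-1) (push (ctx a2 b2 u2) g - push (ctx a1 b1 u1) f))"
        by (rule comb_scale)
      moreover have "scale (-1) (F - G) = G - F" for F G :: "('x, 'a) rpoly"
        by (auto intro!: poly_mapping_eqI simp: lookup_minus)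
      ultimately show ?thesis
        by simp
    qed
  qed
qed

text \<open>
  All terms with leading monomial exactly \<open>w\<close> can be exchanged for multiples of a single one of
  them, at the cost of terms below \<open>w\<close>.
\<close>

lemma comb_split_lead:
  assumes gs: "gs_basis X r S" and "comb S (\<lambda>v. v \<preceq> w) f"
  shows "comb S (\<lambda>v. v \<prec> w) f \<or>
    (\<exists>c. \<exists>a\<in>lists X. \<exists>b\<in>lists X. \<exists>u\<in>rig X. \<exists>s\<in>S. ctx a b u (lm r s) = w \<and>
       comb S (\<lambda>v. v \<prec> w) (f - scale c (push (ctx a b u) s)))"
  using assms(2)
proof (induction f rule: comb.induct)
  case zero
  then show ?case by (simp add: comb.zero)
next
  case (step a b u s h c)
  have leadI: ?case if "a' \<in> lists X" "b' \<in> lists X" "u' \<in> rig X" "s' \<in> S" "ctx a' b' u' (lm r s') = w"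
    "comb S (\<lambda>v. v \<prec> w) (scale c (push (ctx a b u) s) + h - scale d (push (ctx a' b' u') s'))"
    for a' b' u' s' d
    using that
    by (intro disjI2 exI[of _ d] bexI[of _ a'] bexI[of _ b'] bexI[of _ u'] bexI[of _ s'] conjI)
  show ?case
  proof (cases "ctx a b u (lm r s) = w")
    case False
    have lower: "comb S (\<lambda>v. v \<prec> w) (scale c (push (ctx a b u) s))"
      using step False by (intro comb_scale comb_term) auto
    from step.IH show ?thesis
    proof (elim disjE exE bexE conjE)
      assume "comb S (\<lambda>v. v \<prec> w) h"
      then show ?thesis using lower comb_add by blast
    next
      fix d a' b' u' s'
      assume *: "a' \<in> lists X" "b' \<in> lists X" "u' \<in> rig X" "s' \<in> S" "ctx a' b' u' (lm r s') = w"
        and h: "comb S (\<lambda>v. v \<prec> w) (h - scale d (push (ctx a' b' u') s'))"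
      have "comb S (\<lambda>v. v \<prec> w)
          (scale c (push (ctx a b u) s) + h - scale d (push (ctx a' b' u') s'))"
        using comb_add[OF lower h] by (simp add: add_diff_eq)
      then show ?thesis by (rule leadI[OF *])
    qed
  next
    case True
    from step.IH show ?thesis
    proof (elim disjE exE bexE conjE)
      assume "comb S (\<lambda>v. v \<prec> w) h"
      then have "comb S (\<lambda>v. v \<prec> w) (scale c (push (ctx a b u) s) + h - scale c (push (ctx a b u) s))"
        by simp
      then show ?thesis by (rule leadI[OF step.hyps(1-4) True])
    next
      fix d a' b' u' s'
      assume *: "a' \<in> lists X" "b' \<in> lists X" "u' \<in> rig X" "s' \<in> S" "ctx a' b' u' (lm r s') = w"
        and h: "comb S (\<lambda>v. v \<prec> w) (h - scale d (push (ctx a' b' u') s'))"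
      have "comb S (\<lambda>v. v \<prec> w) (push (ctx a' b' u') s' - push (ctx a b u) s)"
        by (rule comb_same_lead[OF gs *(4) step.hyps(4) *(1,2) step.hyps(1,2) *(3) step.hyps(3)
              *(5)[symmetric] True[symmetric]])
      then have "comb S (\<lambda>v. v \<prec> w) (h - scale d (push (ctx a' b' u') s') +
          scale d (push (ctx a' b' u') s' - push (ctx a b u) s))"
        by (intro comb_add comb_scale h)
      also have "h - scale d (push (ctx a' b' u') s') +
          scale d (push (ctx a' b' u') s' - push (ctx a b u) s) =
          scale c (push (ctx a b u) s) + h - scale (c + d) (push (ctx a b u) s)"
        by (auto intro!: poly_mapping_eqI simp: lookup_add lookup_minus algebra_simps)
      finally show ?thesis by (rule leadI[OF step.hyps(1-4) True])
    qed
  qed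
qed

text \<open>
  A combination has finitely many terms, so it is bounded by the largest of their leading
  monomials. This makes induction along the ordering possible, also when \<open>Q\<close> is itself a strict bound.
\<close>

lemma comb_bounded:
  assumes "comb S Q f" "\<And>s. s \<in> S \<Longrightarrow> lm r s \<in> rig X"
  shows "f = 0 \<or> (\<exists>w\<in>rig X. Q w \<and> comb S (\<lambda>v. v \<preceq> w) f)"
  using assms(1)
proof (induction f rule: comb.induct)
  case zero
  then show ?case by simp
next
  case (step a b u s h c)
  let ?v = "ctx a b u (lm r s)"
  have v: "?v \<in> rig X"
    using step assms by (simp add: ctx_in_rig)
  have t: "comb S (\<lambda>x. x \<preceq> w) (scale c (push (ctx a b u) s))" if "?v \<preceq> w" for w
    using step that by (intro comb_scale comb_term)
  from step.IH show ?case
  proof (elim disjE bexE conjE)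
    assume "h = 0"
    then show ?thesis using t[OF preceq_refl[OF v]] v step by auto
  next
    fix w assume w: "w \<in> rig X" "Q w" "comb S (\<lambda>v. v \<preceq> w) h"
    show ?thesis
    proof (cases "?v \<preceq> w")
      case True
      then show ?thesis using w t comb_add by blast
    next
      case False
      then have "w \<preceq> ?v"
        using preceq_total v w by blast
      then have "comb S (\<lambda>x. x \<preceq> ?v) h"
        using w(3) by (elim comb_mono) (blast intro: preceq_trans)
      then have "comb S (\<lambda>x. x \<preceq> ?v) (scale c (push (ctx a b u) s) + h)"
        by (rule comb_add[OF t[OF preceq_refl[OF v]]])
      then show ?thesis
        using v step.hyps(5) by blast
    qed
  qed
qed

text \<open>
  By induction on a bound \<open>w\<close> for the leading monomials of the terms in a representation of \<open>f\<close>. After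
  \<open>comb_split_lead\<close> either only terms below \<open>w\<close> remain and the bound can be lowered, or exactly one
  term has leading monomial \<open>w\<close>. In the latter case nothing can cancel it, so \<open>lm r f = w\<close>.
\<close>

lemma composition_diamond:
  fixes S :: "('x, 'k::field) rpoly set"
  assumes gs: "gs_basis X r S" and f: "f \<in> generated_ideal X S" "f \<noteq> 0"
  shows "\<exists>s\<in>S. divides_in X (lm r s) (lm r f)"
proof -
  note D = gs_basisD[OF gs]
  have S: "S \<subseteq> krig X" using D by blast
  have main: "\<exists>s\<in>S. divides_in X (lm r s) (lm r f)"
    if "w \<in> rig X" "comb S (\<lambda>v. v \<preceq> w) f" "f \<noteq> 0" for w f
    using that
  proof (induction w arbitrary: f rule: mono_induct)
    case (less w)
    have low: ?case if "comb S (\<lambda>v. v \<prec> w) f"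
      using comb_bounded[OF that] D less by blast
    show ?case
    proof (cases "comb S (\<lambda>v. v \<prec> w) f")
      case True
      then show ?thesis by (rule low)
    next
      case False
      then obtain c a b u s where *: "a \<in> lists X" "b \<in> lists X" "u \<in> rig X" "s \<in> S"
        "ctx a b u (lm r s) = w" "comb S (\<lambda>v. v \<prec> w) (f - scale c (push (ctx a b u) s))"
        using comb_split_lead[OF gs less.prems(1)] by blast
      \<comment> \<open>Otherwise \<open>f\<close> would be a combination of terms below \<open>w\<close>.\<close>
      have c: "c \<noteq> 0"
        using False * by auto
      have "w \<notin> Poly_Mapping.keys (f - scale c (push (ctx a b u) s))"
        using comb_keys[OF *(6) S] by blast
      moreover have "Poly_Mapping.lookup (push (ctx a b u) s) w = 1"
        using * D lookup_push[OF inj_ctx] by metis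
      ultimately have "Poly_Mapping.lookup f w = c"
        by (simp add: in_keys_iff lookup_minus)
      then have "w \<in> Poly_Mapping.keys f"
        using c by (simp add: in_keys_iff)
      moreover have "v \<preceq> w" if "v \<in> Poly_Mapping.keys f" for v
      proof -
        have "v \<in> Poly_Mapping.keys (f - scale c (push (ctx a b u) s)) \<or>
            v \<in> Poly_Mapping.keys (push (ctx a b u) s)"
          using that keys_add[of "f - scale c (push (ctx a b u) s)" "scale c (push (ctx a b u) s)"]
            keys_scale[of c "push (ctx a b u) s"] by auto
        then show ?thesis
        proof
          assume "v \<in> Poly_Mapping.keys (push (ctx a b u) s)"
          then show ?thesis
            using keys_push_ctx_preceq[OF *(1-3) D(1)[OF *(4)]] *(5) by simp
        qed (use comb_keys[OF *(6) S] in blast)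
      qed
      ultimately have "lm r f = w"
        by (rule lm_eqI)
      then show ?thesis
        using * divides_inI by metis
    qed
  qed
  have "comb S (\<lambda>_. True) f"
    using f generated_ideal_eq_comb[OF S] by blast
  then show ?thesis
    using comb_bounded[of S "\<lambda>_. True" f] D main f(2) by blast
qed


section \<open>Uniqueness of the reduced basis\<close>

lemma gs_basis_forD:
  assumes "gs_basis_for X r I S"
  shows "gs_basis X r S" "S \<subseteq> I" "\<And>f. f \<in> I \<Longrightarrow> f \<noteq> 0 \<Longrightarrow> \<exists>s\<in>S. divides_in X (lm r s) (lm r f)"
proof -
  show gs: "gs_basis X r S" using assms by (simp add: gs_basis_for_def)
  have "I = generated_ideal X S" using assms by (simp add: gs_basis_for_def)
  then show "S \<subseteq> I" "\<And>f. f \<in> I \<Longrightarrow> f \<noteq> 0 \<Longrightarrow> \<exists>s\<in>S. divides_in X (lm r s) (lm r f)"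
    using composition_diamond[OF gs] by (auto simp: generated_ideal_def)
qed

lemma reduced_divisor_unique:
  assumes "reduced X r S" "s \<in> S" "s' \<in> S" "v \<in> Poly_Mapping.keys s" "divides_in X (lm r s') v"
  shows "s' = s"
proof (rule ccontr)
  assume "s' \<noteq> s"
  then have "s' \<in> S - {s}" using assms by simp
  moreover have "v \<in> Irr X r (S - {s})"
    using assms(1,2,4) unfolding reduced_def by blast
  ultimately show False
    using assms(5) by (auto simp: Irr_iff)
qed

text \<open>
  An element \<open>t\<close> of \<open>T\<close> whose leading monomial divides that of \<open>s\<close> has in turn a leading monomial
  divisible by that of some \<open>s' \<in> S\<close>. Reducedness of \<open>S\<close> forces \<open>s' = s\<close>, so \<open>s\<close> and \<open>t\<close> have the same
  leading monomial; then \<open>s = t\<close>, since \<open>s - t \<in> I\<close> could only have a leading monomial that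
  reducedness forbids. Equality of two reduced bases follows by exchanging \<open>S\<close> and \<open>T\<close>.
\<close>

lemma reduced_subset:
  assumes I: "rig_ideal X I"
    and S: "gs_basis_for X r I S" "reduced X r S" and T: "gs_basis_for X r I T" "reduced X r T"
  shows "S \<subseteq> T"
proof
  fix s assume s: "s \<in> S"
  note SD = gs_basis_forD[OF S(1)] and TD = gs_basis_forD[OF T(1)]
  note sp = gs_basisD[OF SD(1) s]
  have s_lm: "lm r s \<in> Poly_Mapping.keys s"
    using lm_max sp by blast
  obtain t where t: "t \<in> T" "divides_in X (lm r t) (lm r s)"
    using TD(3) SD(2) s sp by blast
  note tp = gs_basisD[OF TD(1) t(1)]
  obtain s' where s': "s' \<in> S" "divides_in X (lm r s') (lm r t)"
    using SD(3) TD(2) t tp by blast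
  have "s' = s"
    using reduced_divisor_unique[OF S(2) s s'(1) s_lm] divides_in_trans s' t by blast
  then have eq: "lm r t = lm r s"
    using preceq_if_divides s' t sp tp preceq_antisym by blast
  have "s = t"
  proof (rule ccontr)
    assume "s \<noteq> t"
    then have ne: "s - t \<noteq> 0" by simp
    have mem: "s - t \<in> I"
      using rig_ideal_diff[OF I] SD(2) TD(2) s t by blast
    have kr: "s - t \<in> krig X"
      using mem by (rule rig_ideal_krig[OF I])
    let ?v = "lm r (s - t)"
    have v: "?v \<in> Poly_Mapping.keys (s - t)"
      using lm_max ne kr by blast
    have less: "?v \<prec> lm r s"
      by (rule keys_diff_prec[OF _ _ _ v]) (use lm_max(2)[OF sp(1,3)] lm_max(2)[OF tp(1,3)] sp tp eq in auto)
    have "?v \<in> Poly_Mapping.keys s \<or> ?v \<in> Poly_Mapping.keys t"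
      using v keys_diff[of s t] by blast
    then show False
    proof
      assume "?v \<in> Poly_Mapping.keys s"
      moreover obtain s1 where "s1 \<in> S" "divides_in X (lm r s1) ?v"
        using SD(3) mem ne by blast
      ultimately have "divides_in X (lm r s) ?v"
        using reduced_divisor_unique[OF S(2) s] by metis
      then have "lm r s \<preceq> ?v"
        using sp by (intro preceq_if_divides)
      then show False
        using less preceq_antisym by blast
    next
      assume "?v \<in> Poly_Mapping.keys t"
      moreover obtain t1 where "t1 \<in> T" "divides_in X (lm r t1) ?v"
        using TD(3) mem ne by blast
      ultimately have "divides_in X (lm r t) ?v"
        using reduced_divisor_unique[OF T(2) t(1)] by metis
      then have "lm r s \<preceq> ?v"
        using preceq_if_divides tp eq by metis
      then show False
        using less preceq_antisym by blast
    qed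
  qed
  then show "s \<in> T" using t by simp
qed


section \<open>Existence of a reduced basis\<close>

text \<open>
  The division algorithm: subtract the multiple of \<open>a s b \<circ> u\<close> that cancels the leading term of \<open>f\<close>. The
  rest is again in \<open>I\<close> and has a smaller leading monomial, so the process stops.
\<close>

lemma comb_lead_bound:
  assumes I: "rig_ideal X I" and S: "S \<subseteq> I" "\<And>s. s \<in> S \<Longrightarrow> monic r s"
    and div: "\<And>f. f \<in> I \<Longrightarrow> f \<noteq> 0 \<Longrightarrow> \<exists>s\<in>S. divides_in X (lm r s) (lm r f)"
    and f: "f \<in> I" "f \<noteq> 0"
  shows "comb S (\<lambda>v. v \<preceq> lm r f) f"
proof -
  have kr: "f \<in> krig X" if "f \<in> I" for f
    using that by (rule rig_ideal_krig[OF I])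
  have "\<forall>f\<in>I. f \<noteq> 0 \<longrightarrow> lm r f = w \<longrightarrow> comb S (\<lambda>v. v \<preceq> w) f" if "w \<in> rig X" for w
    using that
  proof (induction w rule: mono_induct)
    case (less w)
    show ?case
    proof (intro ballI impI)
      fix f assume f: "f \<in> I" "f \<noteq> 0" "lm r f = w"
      obtain s a b u where s: "s \<in> S" "a \<in> lists X" "b \<in> lists X" "u \<in> rig X" "w = ctx a b u (lm r s)"
        using div[OF f(1,2)] f(3) unfolding divides_in_def by blast
      note sp = monicD[OF S(2)[OF s(1)] kr]
      define t where "t = scale (Poly_Mapping.lookup f w) (push (ctx a b u) s)"
      have "push (ctx a b u) s \<in> I"
        using rig_ideal_push_ctx[OF I] s S by blast
      then have tI: "t \<in> I"
        unfolding t_def by (rule rig_ideal_scale[OF I])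
      have t: "comb S (\<lambda>v. v \<preceq> w) t"
        unfolding t_def using s less by (intro comb_scale comb_term) (auto intro: preceq_refl)
      have lower: "v \<prec> w" if "v \<in> Poly_Mapping.keys (f - t)" for v
      proof (rule keys_diff_prec[OF _ _ _ that])
        show "v \<preceq> w" if "v \<in> Poly_Mapping.keys f" for v
          using lm_max(2) kr f that by blast
        show "v \<preceq> w" if "v \<in> Poly_Mapping.keys t" for v
          using keys_push_ctx_preceq[of a b u s v] s kr S(1) subsetD[OF keys_scale that[unfolded t_def]]
          by blast
        show "Poly_Mapping.lookup f w = Poly_Mapping.lookup t w"
          using sp s S(1) by (simp add: t_def lookup_push inj_ctx subset_iff)
      qed
      have "comb S (\<lambda>v. v \<preceq> w) (f - t)"
      proof (cases "f - t = 0")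
        case True
        then show ?thesis by (simp add: comb.zero)
      next
        case False
        have mem: "f - t \<in> I"
          using rig_ideal_diff[OF I] f tI by blast
        then have "lm r (f - t) \<prec> w" "lm r (f - t) \<in> rig X"
          using lower lm_max lm_in_rig kr False by blast+
        then have "comb S (\<lambda>v. v \<preceq> lm r (f - t)) (f - t)"
          using less.IH mem False by blast
        then show ?thesis
          using \<open>lm r (f - t) \<prec> w\<close> by (elim comb_mono) (blast intro: preceq_trans)
      qed
      then have "comb S (\<lambda>v. v \<preceq> w) (f - t + t)"
        using t by (rule comb_add)
      then show "comb S (\<lambda>v. v \<preceq> w) f" by simp
    qed
  qed
  then show ?thesis
    using f lm_in_rig kr by blast
qed

text \<open>
  Both types of composition are differences of two terms with leading monomial \<open>w\<close>. This common
  form is what makes the leading terms cancel in either type.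
\<close>

lemma composition_cases:
  assumes "composition1 X r f g w h \<or> composition2 X r f g w h"
    and "f \<in> krig X" "f \<noteq> 0" "g \<in> krig X" "g \<noteq> 0"
  obtains a b u a' b' u' where "a \<in> lists X" "b \<in> lists X" "u \<in> rig X"
    "a' \<in> lists X" "b' \<in> lists X" "u' \<in> rig X"
    "w = ctx a b u (lm r f)" "w = ctx a' b' u' (lm r g)"
    "h = push (ctx a b u) f - push (ctx a' b' u') g"
proof -
  have rig: "u \<in> rig X \<and> v \<in> rig X"
    if "lcm_circ p q = p + u" "lcm_circ p q = q + v" "p \<in> rig X" "q \<in> rig X" for p q u v
    using that rig_diff by (auto simp: lcm_circ_left) (metis rig_plus)
  have lmr: "lm r f \<in> rig X" "lm r g \<in> rig X"
    using assms lm_in_rig by auto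
  from assms(1) show thesis
  proof
    assume "composition1 X r f g w h"
    then obtain a b u v where *: "a \<in> lists X" "b \<in> lists X"
      "w = lcm_circ (lm r f \<cdot> {#a#}) ({#b#} \<cdot> lm r g)" "w = lm r f \<cdot> {#a#} + u" "w = {#b#} \<cdot> lm r g + v"
      "h = (f \<odot> mon {#a#}) * mon u - (mon {#b#} \<odot> g) * mon v"
      unfolding composition1_def Let_def by blast
    have e: "lm r f \<cdot> {#a#} = ctx [] a {#} (lm r f)" "{#b#} \<cdot> lm r g = ctx b [] {#} (lm r g)"
      by (simp_all add: ctx_def mdot_word_left mdot_word_right)
    have "u \<in> rig X \<and> v \<in> rig X"
      by (rule rig[of "lm r f \<cdot> {#a#}" "{#b#} \<cdot> lm r g"]) (use * e lmr in \<open>auto intro!: ctx_in_rig\<close>)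
    moreover have "w = ctx [] a u (lm r f)" "w = ctx b [] v (lm r g)"
      using *(4,5) e by (auto simp: ctx_plus)
    moreover have "h = push (ctx [] a u) f - push (ctx b [] v) g"
      using *(6) by (simp add: word_pdot_ctx pdot_word_ctx push_ctx_times_mon)
    ultimately show thesis
      using that[of "[]" a u b "[]" v] * by blast
  next
    assume "composition2 X r f g w h"
    then obtain a b u v where *: "a \<in> lists X" "b \<in> lists X"
      "w = lcm_circ (lm r f) (msandwich a (lm r g) b)" "w = lm r f + u" "w = msandwich a (lm r g) b + v"
      "h = f * mon u - psandwich a g b * mon v"
      unfolding composition2_def Let_def by blast
    have "u \<in> rig X \<and> v \<in> rig X"
      by (rule rig[of "lm r f" "msandwich a (lm r g) b"])
        (use * lmr in \<open>auto simp: msandwich_eq_ctx intro!: ctx_in_rig\<close>)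
    moreover have "w = ctx [] [] u (lm r f)" "w = ctx a b v (lm r g)"
      using *(4,5) by (auto simp: ctx_plus msandwich_eq_ctx)
    moreover have "h = push (ctx [] [] u) f - push (ctx a b v) g"
      using *(6) by (simp add: psandwich_eq_push push_ctx_times_mon times_mon_ctx[of f u])
    ultimately show thesis
      using that[of "[]" "[]" u a b v] * by blast
  qed
qed

lemma gs_basis_forI:
  assumes I: "rig_ideal X I" and S: "S \<subseteq> I" "\<And>s. s \<in> S \<Longrightarrow> monic r s"
    and div: "\<And>f. f \<in> I \<Longrightarrow> f \<noteq> 0 \<Longrightarrow> \<exists>s\<in>S. divides_in X (lm r s) (lm r f)"
  shows "gs_basis_for X r I S"
proof -
  have kr: "f \<in> krig X" if "f \<in> I" for f
    using that by (rule rig_ideal_krig[OF I])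
  have Sk: "S \<subseteq> krig X" using kr S by blast
  have "trivial_mod X r S w h" if fg: "f \<in> S" "g \<in> S"
    and h: "composition1 X r f g w h \<or> composition2 X r f g w h" for f g w h
  proof -
    note fp = monicD[OF S(2)[OF fg(1)]] and gp = monicD[OF S(2)[OF fg(2)]]
    have fgk: "f \<in> krig X" "g \<in> krig X" using fg Sk by auto
    obtain a b u a' b' u' where *: "a \<in> lists X" "b \<in> lists X" "u \<in> rig X"
      "a' \<in> lists X" "b' \<in> lists X" "u' \<in> rig X"
      "w = ctx a b u (lm r f)" "w = ctx a' b' u' (lm r g)"
      "h = push (ctx a b u) f - push (ctx a' b' u') g"
      using composition_cases[OF h] fgk fp gp by blast
    have lower: "v \<prec> w" if "v \<in> Poly_Mapping.keys h" for v
    proof (rule keys_diff_prec[OF _ _ _ that[unfolded *(9)]])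
      show "v \<preceq> w" if "v \<in> Poly_Mapping.keys (push (ctx a b u) f)" for v
        using keys_push_ctx_preceq[of a b u f v] * fgk that by simp
      show "v \<preceq> w" if "v \<in> Poly_Mapping.keys (push (ctx a' b' u') g)" for v
        using keys_push_ctx_preceq[of a' b' u' g v] * fgk that by simp
      show "Poly_Mapping.lookup (push (ctx a b u) f) w = Poly_Mapping.lookup (push (ctx a' b' u') g) w"
        using lookup_push[OF inj_ctx] fp(3) gp(3) fgk *(7,8) by metis
    qed
    have hI: "h \<in> I"
      unfolding *(9) using * S(1) fg by (intro rig_ideal_diff[OF I] rig_ideal_push_ctx[OF I]) auto
    have "comb S (\<lambda>v. v \<prec> w) h"
    proof (cases "h = 0")
      case True
      then show ?thesis by (simp add: comb.zero)
    next
      case False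
      then have "lm r h \<prec> w"
        using lower lm_max kr hI by blast
      moreover have "comb S (\<lambda>v. v \<preceq> lm r h) h"
        using comb_lead_bound[OF I S div hI False] by blast
      ultimately show ?thesis
        by (elim comb_mono) (rule preceq_prec_trans)
    qed
    then show ?thesis
      by (simp add: trivial_mod_iff_comb)
  qed
  then have "gs_basis X r S"
    using Sk S(2) unfolding gs_basis_def by blast
  moreover have "comb S (\<lambda>_. True) f" if "f \<in> I" for f
  proof (cases "f = 0")
    case True
    then show ?thesis by (simp add: comb.zero)
  next
    case False
    show ?thesis
      using comb_lead_bound[OF I S div that False] by (rule comb_mono) auto
  qed
  then have "generated_ideal X S = I"
    using generated_ideal_eq_comb[OF Sk] comb_in_ideal[OF _ I S(1)] by blast
  ultimately show ?thesis
    by (simp add: gs_basis_for_def)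
qed

definition lead_monos :: "('x, 'k::field) rpoly set \<Rightarrow> 'x mono set" where
  "lead_monos I = {lm r f |f. f \<in> I \<and> f \<noteq> 0}"

text \<open>
  By linearity it suffices to treat a single monomial \<open>w\<close>. If \<open>w\<close> is the leading monomial of some
  \<open>g \<in> I\<close>, then modulo \<open>I\<close> it is congruent to a polynomial in smaller monomials, which have normal
  forms by induction.
\<close>

lemma ex_normal_form:
  fixes I :: "('x, 'k::field) rpoly set"
  assumes I: "rig_ideal X I" and f: "f \<in> krig X"
  shows "\<exists>n\<in>krig X. Poly_Mapping.keys n \<inter> lead_monos I = {} \<and> f - n \<in> I"
proof -
  \<comment> \<open>The polynomials that have a normal form make up a subspace.\<close>
  define N where "N = {f :: ('x, 'k) rpoly. \<exists>n\<in>krig X. Poly_Mapping.keys n \<inter> lead_monos I = {} \<and> f - n \<in> I}"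
  have kr: "f \<in> krig X" if "f \<in> I" for f
    using that by (rule rig_ideal_krig[OF I])
  have zero: "0 \<in> N"
    unfolding N_def using rig_ideal_0[OF I] by (auto intro!: bexI[of _ 0])
  have add: "f + g \<in> N" if fg: "f \<in> N" "g \<in> N" for f g
  proof -
    obtain n m where *: "n \<in> krig X" "Poly_Mapping.keys n \<inter> lead_monos I = {}" "f - n \<in> I"
      "m \<in> krig X" "Poly_Mapping.keys m \<inter> lead_monos I = {}" "g - m \<in> I"
      using fg unfolding N_def by blast
    have "(f - n) + (g - m) \<in> I"
      using * by (intro rig_ideal_add[OF I])
    then have "(f + g) - (n + m) \<in> I"
      by (simp add: algebra_simps)
    then show ?thesis
      unfolding N_def using * keys_add[of n m] by (blast intro: krig_add)
  qed
  have scale: "scale c f \<in> N" if f: "f \<in> N" for f c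
  proof -
    obtain n where *: "n \<in> krig X" "Poly_Mapping.keys n \<inter> lead_monos I = {}" "f - n \<in> I"
      using f unfolding N_def by blast
    have "scale c (f - n) \<in> I"
      using * by (intro rig_ideal_scale[OF I])
    also have "scale c (f - n) = scale c f - scale c n"
      by (rule poly_mapping_eqI) (simp add: lookup_minus right_diff_distrib)
    finally show ?thesis
      unfolding N_def using * keys_scale[of c n] by (blast intro: krig_scale)
  qed
  have span: "f \<in> N" if "\<And>w. w \<in> Poly_Mapping.keys f \<Longrightarrow> mon w \<in> N" for f
  proof -
    have *: "(\<Sum>w\<in>A. Poly_Mapping.single w (Poly_Mapping.lookup f w)) \<in> N"
      if "\<And>w. w \<in> A \<Longrightarrow> mon w \<in> N" for A
      using that
    proof (induction A rule: infinite_finite_induct)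
      case (insert w A)
      have "scale (Poly_Mapping.lookup f w) (mon w) \<in> N"
        using insert by (intro scale) auto
      then show ?case
        using insert by (auto intro: add)
    qed (auto intro: zero)
    then have "push (\<lambda>w. w) f \<in> N"
      unfolding push_def using that by blast
    then show ?thesis by (simp add: push_ident)
  qed
  have "mon w \<in> N" if "w \<in> rig X" for w
    using that
  proof (induction w rule: mono_induct)
    case (less w)
    show ?case
    proof (cases "w \<in> lead_monos I")
      case False
      then show ?thesis
        unfolding N_def using less rig_ideal_0[OF I] by (intro CollectI bexI[of _ "mon w"]) (auto simp: krig_def)
    next
      case True
      then obtain g where g: "g \<in> I" "g \<noteq> 0" "lm r g = w"
        unfolding lead_monos_def by blast
      have gk: "g \<in> krig X" using g kr by blast
      define c where "c = Poly_Mapping.lookup g w"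
      have c: "c \<noteq> 0"
        using lm_max(1)[OF gk g(2)] g(3) by (simp add: c_def in_keys_iff)
      define g' where "g' = scale (inverse c) g"
      have g'I: "g' \<in> I"
        unfolding g'_def using g by (intro rig_ideal_scale[OF I])
      have "mon w - g' \<in> N"
      proof (rule span)
        fix v assume v: "v \<in> Poly_Mapping.keys (mon w - g')"
        have "v \<prec> w"
        proof (rule keys_diff_prec[OF _ _ _ v])
          show "v \<preceq> w" if "v \<in> Poly_Mapping.keys (mon w)" for v
            using that less by (auto simp: preceq_refl split: if_splits)
          show "v \<preceq> w" if "v \<in> Poly_Mapping.keys g'" for v
            using subsetD[OF keys_scale that[unfolded g'_def]] lm_max(2)[OF gk g(2)] g(3) by blast
          show "Poly_Mapping.lookup (mon w) w = Poly_Mapping.lookup g' w"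
            using c by (simp add: g'_def c_def)
        qed
        moreover have "v \<in> rig X"
          using v kr[OF g'I] less keys_diff[of "mon w" g'] by (auto simp: krig_def)
        ultimately show "mon v \<in> N"
          using less by blast
      qed
      moreover have "g' \<in> N"
        unfolding N_def using g'I by (auto intro!: bexI[of _ 0])
      ultimately have "mon w - g' + g' \<in> N"
        by (rule add)
      then show ?thesis by simp
    qed
  qed
  then have "f \<in> N"
    using span f by (auto simp: krig_def)
  then show ?thesis
    by (simp add: N_def)
qed

text \<open>
  For \<open>s = w - n\<close> with a normal form \<open>n\<close> of \<open>w\<close>, the leading monomial of \<open>s\<close> lies in \<open>lead_monos I\<close>, and \<open>w\<close>
  is the only such monomial that occurs in \<open>s\<close>. Thus no bound on the size of \<open>n\<close> has to be carried
  through the construction of normal forms.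
\<close>

lemma ex_tail_reduced:
  assumes I: "rig_ideal X I" and w: "w \<in> lead_monos I"
  shows "\<exists>s\<in>I. monic r s \<and> lm r s = w \<and> Poly_Mapping.keys s \<inter> lead_monos I = {w}"
proof -
  have kr: "f \<in> krig X" if "f \<in> I" for f
    using that by (rule rig_ideal_krig[OF I])
  have wr: "w \<in> rig X"
    using w lm_in_rig kr unfolding lead_monos_def by blast
  then have "mon w \<in> krig X" by (simp add: krig_def)
  then obtain n where n: "n \<in> krig X" "Poly_Mapping.keys n \<inter> lead_monos I = {}" "mon w - n \<in> I"
    using ex_normal_form[OF I] by blast
  let ?s = "mon w - n"
  have "w \<notin> Poly_Mapping.keys n"
    using n w by blast
  then have lk: "Poly_Mapping.lookup ?s w = 1"
    by (simp add: lookup_minus in_keys_iff)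
  then have ne: "?s \<noteq> 0"
    by (metis lookup_zero zero_neq_one)
  have keys: "Poly_Mapping.keys ?s \<subseteq> insert w (Poly_Mapping.keys n)"
    using keys_diff[of "mon w" n] by auto
  have "lm r ?s \<in> lead_monos I"
    using n ne unfolding lead_monos_def by blast
  then have lm: "lm r ?s = w"
    using lm_max(1)[OF kr[OF n(3)] ne] keys n by blast
  have "w \<in> Poly_Mapping.keys ?s"
    using lk by (simp add: in_keys_iff)
  then have "Poly_Mapping.keys ?s \<inter> lead_monos I = {w}"
    using keys n w by blast
  then show ?thesis
    using n lm lk ne by (intro bexI[of _ ?s] conjI) (auto simp: monic_def)
qed

lemma ex_minimal_divisor:
  assumes M: "M \<subseteq> rig X" and w: "w \<in> M"
  shows "\<exists>v\<in>M. divides_in X v w \<and> (\<forall>v'\<in>M. divides_in X v' v \<longrightarrow> v' = v)"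
proof -
  have "w \<in> rig X" using assms by blast
  then show ?thesis using w
  proof (induction w rule: mono_induct)
    case (less w)
    show ?case
    proof (cases "\<forall>v'\<in>M. divides_in X v' w \<longrightarrow> v' = w")
      case True
      then show ?thesis using less divides_in_refl by blast
    next
      case False
      then obtain v' where v': "v' \<in> M" "divides_in X v' w" "v' \<noteq> w" by blast
      then have "v' \<in> rig X" "v' \<prec> w"
        using M preceq_if_divides by blast+
      then show ?thesis
        using less v' divides_in_trans by blast
    qed
  qed
qed

text \<open>
  The basis consists of all monic elements of \<open>I\<close> whose leading monomial is minimal under
  divisibility and is their only monomial in \<open>lead_monos I\<close>. No choice is involved: two such elements
  with the same leading monomial differ by an element of \<open>I\<close> without any monomial in
  \<open>lead_monos I\<close>, which must be \<open>0\<close>.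
\<close>

lemma ex_reduced:
  assumes I: "rig_ideal X I"
  shows "\<exists>S. gs_basis_for X r I S \<and> reduced X r S"
proof -
  let ?M = "lead_monos I"
  define S where "S = {s \<in> I. monic r s \<and> Poly_Mapping.keys s \<inter> ?M = {lm r s} \<and>
    (\<forall>v\<in>?M. divides_in X v (lm r s) \<longrightarrow> v = lm r s)}"
  have kr: "f \<in> krig X" if "f \<in> I" for f
    using that by (rule rig_ideal_krig[OF I])
  have M: "?M \<subseteq> rig X"
    using lm_in_rig kr unfolding lead_monos_def by blast
  have lead: "lm r f \<in> ?M" if "f \<in> I" "f \<noteq> 0" for f
    using that unfolding lead_monos_def by blast
  have up: "v \<in> ?M" if "divides_in X (lm r f) v" "f \<in> I" "f \<noteq> 0" for f v
  proof -
    obtain a b u where *: "a \<in> lists X" "b \<in> lists X" "u \<in> rig X" "v = ctx a b u (lm r f)"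
      using \<open>divides_in X (lm r f) v\<close> unfolding divides_in_def by blast
    then have "v = lm r (push (ctx a b u) f)"
      using lm_push_ctx kr that by metis
    then show ?thesis
      using lead rig_ideal_push_ctx[OF I] push_eq_0_iff[OF inj_ctx] * that by metis
  qed
  have "gs_basis_for X r I S"
  proof (rule gs_basis_forI[OF I])
    show "S \<subseteq> I" "\<And>s. s \<in> S \<Longrightarrow> monic r s"
      by (auto simp: S_def)
    fix f assume "f \<in> I" "f \<noteq> 0"
    then obtain v where v: "v \<in> ?M" "divides_in X v (lm r f)" "\<forall>v'\<in>?M. divides_in X v' v \<longrightarrow> v' = v"
      using ex_minimal_divisor[OF M lead] by blast
    then obtain s where "s \<in> I" "monic r s" "lm r s = v" "Poly_Mapping.keys s \<inter> ?M = {v}"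
      using ex_tail_reduced[OF I] by blast
    then show "\<exists>s\<in>S. divides_in X (lm r s) (lm r f)"
      using v by (intro bexI[of _ s]) (auto simp: S_def)
  qed
  moreover have "reduced X r S"
    unfolding reduced_def
  proof (intro ballI subsetI)
    fix s v assume s: "s \<in> S" and v: "v \<in> Poly_Mapping.keys s"
    have sI: "s \<in> I" "monic r s" "Poly_Mapping.keys s \<inter> ?M = {lm r s}"
      "\<And>v. v \<in> ?M \<Longrightarrow> divides_in X v (lm r s) \<Longrightarrow> v = lm r s"
      using s by (auto simp: S_def)
    have "\<not> divides_in X (lm r t) v" if "t \<in> S - {s}" for t
    proof
      assume d: "divides_in X (lm r t) v"
      have t: "t \<in> I" "monic r t" "Poly_Mapping.keys t \<inter> ?M = {lm r t}" "t \<noteq> s"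
        using that by (auto simp: S_def)
      have t0: "t \<noteq> 0" using t by (simp add: monic_def)
      have "v = lm r s"
        using up[OF d t(1) t0] v sI(3) by blast
      then have eq: "lm r t = lm r s"
        using sI(4) d lead[OF t(1) t0] by blast
      have mem: "s - t \<in> I"
        using rig_ideal_diff[OF I] sI t by blast
      have ne: "s - t \<noteq> 0" using t by simp
      have key: "lm r (s - t) \<in> Poly_Mapping.keys (s - t)"
        using lm_max(1)[OF kr[OF mem] ne] .
      moreover have "lm r (s - t) \<in> ?M"
        using lead mem ne by blast
      ultimately have "lm r (s - t) \<in> Poly_Mapping.keys s \<inter> ?M \<union> Poly_Mapping.keys t \<inter> ?M"
        using subsetD[OF keys_diff] by fast
      then have "lm r (s - t) = lm r s"
        unfolding sI(3) t(3) eq by simp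
      then show False
        using key sI(2) t(2) eq by (simp add: monic_def in_keys_iff lookup_minus)
    qed
    moreover have "v \<in> rig X"
      using kr[OF sI(1)] v by (auto simp: krig_def)
    ultimately show "v \<in> Irr X r (S - {s})"
      by (simp add: Irr_iff)
  qed
  ultimately show ?thesis by blast
qed

end


section \<open>The reduced basis of an ideal\<close>

theorem theorem3p5:
  fixes X :: "'x set" and I :: "('x, 'k::field) rpoly set" and r :: "'x mono rel"
  assumes "rig_ideal X I" and "monomial_ordering X r"
  shows "\<exists>!S. gs_basis_for X r I S \<and> reduced X r S"
proof -
  interpret ordered_rig X r
    using assms(2) by unfold_locales
  show ?thesis
    using ex_reduced[OF assms(1)] reduced_subset[OF assms(1)] by (blast)
qed

end
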